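(* Let $m \geq 2$, let $\mu \in \mathbb{R}\setminus\{0\}$, and let $u$ be $\mu$-panharmonic in a domain $D \subset \mathbb{R}^m$. Let $r > 0$ be such that $D_r = \{x \in D : \overline{B_r(x)} \subset D\}$ is nonempty. Then $M^\circ(u,\cdot,r)$ is $\mu$-panharmonic in $D_r$, and \[ I(u,x,r',r) = a^\circ(\mu r')\, M^\circ(u,x,r) = a^\circ(\mu r')\, a^\circ(\mu r)\, u(x) \] for every $x \in D_r$ and every $r'>0$ such that $\overline{B_{r'}(x)} \subset D_r$.
   Context: A domain is a connected open set. A real-valued $C^2$ function $u$ on an open set is called $\mu$-panharmonic there if $\nabla^2 u - \mu^2 u = 0$. $B_r(x)$ is the open ball of radius $r$ centred at $x$, $S_r(x)=\partial B_r(x)$, and $\omega_m = 2\pi^{m/2}/\Gamma(m/2)$ is the area of the unit sphere in $\mathbb{R}^m$. The spherical mean is $M^\circ(u,x,r) = \omega_m^{-1}\int_{S_1(0)} u(x+ry)\,dS_y$. The iterated spherical mean is \[ I(u,x,r',r) = M^\circ(M^\circ(u,\cdot,r),x,r') = \frac{1}{\omega_m^2}\int_{S_1(0)}\int_{S_1(0)} u(x+r'y+rz)\,dS_z\,dS_y . \] The function $a^\circ$ is $a^\circ(t) = \Gamma(m/2)\, I_{(m-2)/2}(t)/(t/2)^{(m-2)/2}$, where $I_\nu$ is the modified Bessel function of the first kind of order $\nu$; it is understood as the even entire function given by its power series, with $a^\circ(0)=1$. *)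

theory Defs
  imports "HOL-Analysis.Analysis"
begin

subsection \<open>Panharmonic functions\<close>

definition partial_deriv :: "'a::euclidean_space \<Rightarrow> ('a \<Rightarrow> real) \<Rightarrow> 'a \<Rightarrow> real" where
  "partial_deriv b u x = deriv (\<lambda>t. u (x + t *\<^sub>R b)) 0"

text \<open>Intended for open \<open>S\<close>: all iterated partial derivatives of \<open>u\<close> up to order \<open>k\<close> exist
  and are continuous on \<open>S\<close>. The values of \<open>u\<close> outside \<open>S\<close> then play no role.\<close>

primrec Ck_on :: "nat \<Rightarrow> 'a::euclidean_space set \<Rightarrow> ('a \<Rightarrow> real) \<Rightarrow> bool" where
  "Ck_on 0 S u \<longleftrightarrow> continuous_on S u"
| "Ck_on (Suc k) S u \<longleftrightarrow> continuous_on S u \<and>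
     (\<forall>b\<in>Basis. (\<forall>x\<in>S. (\<lambda>t::real. u (x + t *\<^sub>R b)) differentiable (at 0)) \<and>
                Ck_on k S (partial_deriv b u))"

definition Laplacian :: "('a::euclidean_space \<Rightarrow> real) \<Rightarrow> 'a \<Rightarrow> real" where
  "Laplacian u x = (\<Sum>b\<in>Basis. partial_deriv b (partial_deriv b u) x)"

definition panharmonic_on :: "real \<Rightarrow> 'a::euclidean_space set \<Rightarrow> ('a \<Rightarrow> real) \<Rightarrow> bool" where
  "panharmonic_on \<mu> S u \<longleftrightarrow>
     open S \<and> Ck_on 2 S u \<and> (\<forall>x\<in>S. Laplacian u x - \<mu>\<^sup>2 * u x = 0)"

text \<open>The set written \<open>D\<^sub>r\<close> in the mathematics (for \<open>r > 0\<close>).\<close>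

definition inner_set :: "'a::euclidean_space set \<Rightarrow> real \<Rightarrow> 'a set" where
  "inner_set D r = {x\<in>D. cball x r \<subseteq> D}"

subsection \<open>Spherical means\<close>

text \<open>Surface area measure on the unit sphere, given by the polar-coordinates construction:
  with \<open>m\<close> the dimension, the area of \<open>A\<close> is \<open>m\<close> times the Lebesgue measure of the cone
  \<open>{t y. y \<in> A, 0 < t < 1}\<close>. Its underlying space is the sphere itself, so that measurability
  of an integrand involves only its values on the sphere.\<close>

definition sphere_area :: "'a::euclidean_space measure" where
  "sphere_area = scale_measure (of_nat DIM('a))
     (distr (restrict_space lborel (ball 0 1 - {0}))
            (restrict_space borel (sphere 0 1)) (\<lambda>x. x /\<^sub>R norm x))"

definition sphere_const :: "nat \<Rightarrow> real" where
  "sphere_const m = 2 * pi powr (real m / 2) / Gamma (real m / 2)"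

definition spherical_mean :: "('a::euclidean_space \<Rightarrow> real) \<Rightarrow> 'a \<Rightarrow> real \<Rightarrow> real" where
  "spherical_mean u x r =
     1 / sphere_const DIM('a) * (LINT y|sphere_area. u (x + r *\<^sub>R y))"

definition iterated_mean ::
    "('a::euclidean_space \<Rightarrow> real) \<Rightarrow> 'a \<Rightarrow> real \<Rightarrow> real \<Rightarrow> real" where
  "iterated_mean u x r' r = spherical_mean (\<lambda>y. spherical_mean u y r) x r'"

lemma iterated_mean_eq_double_integral:
  fixes u :: "'a::euclidean_space \<Rightarrow> real"
  shows "iterated_mean u x r' r = 1 / (sphere_const DIM('a))\<^sup>2 *
    (LINT y|sphere_area. (LINT z|sphere_area. u (x + r' *\<^sub>R y + r *\<^sub>R z)))"
  unfolding iterated_mean_def spherical_mean_def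
  by (simp add: power2_eq_square)

lemma cone_projection_measurable:
  "(\<lambda>x. x /\<^sub>R norm x) \<in> restrict_space lborel (ball (0::'a::euclidean_space) 1 - {0})
     \<rightarrow>\<^sub>M restrict_space borel (sphere 0 1)"
  by (rule measurable_restrict_space2)
     (auto simp: space_restrict_space intro!: measurable_restrict_space1)

lemma space_sphere_area: "space (sphere_area :: 'a::euclidean_space measure) = sphere 0 1"
  by (simp add: sphere_area_def space_restrict_space space_scale_measure)

lemma emeasure_sphere_area:
  fixes A :: "'a::euclidean_space set"
  assumes "A \<in> sets borel" "A \<subseteq> sphere 0 1"
  shows "emeasure sphere_area A =
    of_nat DIM('a) * emeasure lborel {x \<in> ball 0 1 - {0}. x /\<^sub>R norm x \<in> A}"
proof -
  have A: "A \<in> sets (restrict_space borel (sphere 0 1))"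
    using assms by (auto simp: sets_restrict_space)
  have eq: "(\<lambda>x. x /\<^sub>R norm x) -` A \<inter> space (restrict_space lborel (ball (0::'a) 1 - {0}))
      = {x \<in> ball 0 1 - {0}. x /\<^sub>R norm x \<in> A}"
    by (auto simp: space_restrict_space)
  show ?thesis
    unfolding sphere_area_def
    by (simp only: emeasure_scale_measure emeasure_distr[OF cone_projection_measurable A] eq)
       (subst emeasure_restrict_space, auto)
qed

lemma emeasure_sphere_area_space:
  "emeasure sphere_area (sphere (0::'a::euclidean_space) 1) = ennreal (sphere_const DIM('a))"
proof -
  have eq: "{x \<in> ball 0 1 - {0}. x /\<^sub>R norm x \<in> sphere (0::'a) 1} = ball 0 1 - {0}"
    by auto
  have m: "emeasure lborel (ball (0::'a) 1 - {0}) = ennreal (unit_ball_vol (real DIM('a)))"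
    by (subst emeasure_Diff_null_set) (auto simp: emeasure_ball)
  have pos: "real DIM('a) / 2 > 0" by simp
  then have "real DIM('a) / 2 \<notin> \<int>\<^sub>\<le>\<^sub>0" by (meson nonpos_Ints_nonpos not_less)
  from Gamma_plus1[OF this] Gamma_real_pos[OF pos]
  have "real DIM('a) * unit_ball_vol (real DIM('a)) = sphere_const DIM('a)"
    unfolding unit_ball_vol_def sphere_const_def by (simp only:) (simp add: field_simps)
  then have "of_nat DIM('a) * ennreal (unit_ball_vol (real DIM('a))) = ennreal (sphere_const DIM('a))"
    by (metis ennreal_mult' ennreal_of_nat_eq_real_of_nat of_nat_0_le_iff)
  moreover have "sphere (0::'a) 1 \<in> sets borel" by (simp add: borel_closed)
  ultimately show ?thesis
    using emeasure_sphere_area[of "sphere (0::'a) 1", unfolded eq m] by simp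
qed

subsection \<open>Modified Bessel function and \<open>a\<degree>\<close>\<close>

text \<open>Defining series of the modified Bessel function of the first kind; meant for \<open>t > 0\<close>
  and \<open>\<nu>\<close> not a negative integer.\<close>

definition bessel_I :: "real \<Rightarrow> real \<Rightarrow> real" where
  "bessel_I \<nu> t = (t / 2) powr \<nu> *
     (\<Sum>k. (t / 2) ^ (2 * k) / (fact k * Gamma (real k + \<nu> + 1)))"

text \<open>Real restriction of the even entire function, needed for arguments of either sign:
  the power of \<open>t/2\<close> in front of the Bessel series is cancelled.\<close>

definition a_circ :: "nat \<Rightarrow> real \<Rightarrow> real" where
  "a_circ m t = Gamma (real m / 2) *
     (\<Sum>k. (t / 2) ^ (2 * k) / (fact k * Gamma (real k + real m / 2)))"

lemma a_circ_bessel_I: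
  assumes "t > 0"
  shows "a_circ m t = Gamma (real m / 2) * bessel_I ((real m - 2) / 2) t
                        / (t / 2) powr ((real m - 2) / 2)"
proof -
  have "real k + (real m - 2) / 2 + 1 = real k + real m / 2" for k
    by (simp add: field_simps)
  then show ?thesis
    unfolding a_circ_def bessel_I_def using assms by (simp only:) simp
qed

lemma a_circ_0:
  assumes "m > 0"
  shows "a_circ m 0 = 1"
proof -
  have "(\<Sum>k. (0 / 2 :: real) ^ (2 * k) / (fact k * Gamma (real k + real m / 2)))
      = 1 / Gamma (real m / 2)"
    by (subst suminf_finite[of "{0}"]) auto
  moreover have "Gamma (real m / 2) \<noteq> 0"
    using assms by (simp add: Gamma_eq_zero_iff) (auto elim!: nonpos_Ints_cases)
  ultimately show ?thesis by (simp add: a_circ_def)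
qed

lemma a_circ_minus: "a_circ m (- t) = a_circ m t"
  by (simp add: a_circ_def)

end

theory Submission
  imports Defs
begin

text \<open>The whole statement follows from the mean value property
\<open>spherical_mean u x r = a_circ m (\<mu> * r) * u x\<close>, valid whenever \<open>u\<close> is \<open>\<mu>\<close>-panharmonic on an
open set containing \<open>cball x r\<close> (lemma \<open>spherical_mean_panharmonic\<close>). It shows that on
\<open>inner_set D r\<close> the spherical mean is a constant multiple of \<open>u\<close>, hence panharmonic there; and
applying it a second time, to the spherical mean itself, evaluates the iterated mean.

The mean value property is obtained from integrals over balls. For fixed \<open>x\<close> let
\<open>P k R\<close> be the integral of \<open>(1 - (norm z)\<^sup>2) ^ k * u (x + R *\<^sub>R z)\<close> over the unit ball.
Integrating by parts against the gradient of \<open>u\<close> and using \<open>\<Delta>u = \<mu>\<^sup>2 u\<close> gives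
\<open>P k' R = \<mu>\<^sup>2 * R / (2 * (k + 1)) * P (k + 1) R\<close> (lemma \<open>weighted_ball_integral_panharmonic\<close>).
So every \<open>P k\<close> can be differentiated arbitrarily often with respect to \<open>R\<^sup>2\<close>, and its derivatives
are multiples of the functions \<open>P (k + n)\<close>, which are bounded uniformly in \<open>n\<close>. Therefore \<open>P k\<close> is the sum of its Taylor
series, whose coefficients are \<open>u x\<close> times the elementary integrals of \<open>(1 - (norm z)\<^sup>2) ^ k\<close>
(lemmas \<open>iterated_derivative_series\<close> and \<open>bump_integral_eq\<close>).

The surface measure is \<open>m\<close> times the image of Lebesgue measure on the ball under radial
projection, with \<open>m\<close> the dimension. The
divergence theorem for the field \<open>z \<mapsto> u (x + R *\<^sub>R z) *\<^sub>R z\<close> then turns the sphere integral into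
\<open>m * P 0 R + R * P 0' R\<close>, that is, into a combination of \<open>P 0\<close> and
\<open>P 1\<close>; the sum of the two power series is the series of \<open>a_circ\<close>.

Both divergence theorems are derived from the behaviour of Lebesgue measure under translations
and dilations: differentiate the integral of \<open>F (z + t *\<^sub>R b)\<close> or of \<open>F (t *\<^sub>R z)\<close> in \<open>t\<close>, for a
function \<open>F\<close> that vanishes outside the unit ball and is Lipschitz along these motions.\<close>

section \<open>Differentiation tools\<close>

text \<open>Dominated convergence for difference quotients. Asking for a derivative at \<open>t0\<close> almost
everywhere, together with a Lipschitz bound relative to \<open>t0\<close>, admits integrands cut off at the
unit sphere, where they have a kink.\<close>

lemma has_real_derivative_under_integral:
  fixes f :: "real \<Rightarrow> 'b \<Rightarrow> real"
  assumes d: "d > 0"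
    and int: "\<And>t. \<bar>t - t0\<bar> < d \<Longrightarrow> integrable M (f t)"
    and deriv: "AE x in M. ((\<lambda>t. f t x) has_real_derivative f' x) (at t0)"
    and dom: "\<And>t x. \<bar>t - t0\<bar> < d \<Longrightarrow> \<bar>f t x - f t0 x\<bar> \<le> B x * \<bar>t - t0\<bar>"
    and B: "integrable M B"
    and f': "f' \<in> borel_measurable M"
  shows "((\<lambda>t. LINT x|M. f t x) has_real_derivative (LINT x|M. f' x)) (at t0)"
proof -
  \<comment> \<open>Working within a neighbourhood where the Lipschitz bound holds, every sequence can be used without discarding initial terms.\<close>
  define S where "S = {t0 - d<..<t0 + d}"
  have S: "open S" "t0 \<in> S" and S_iff: "t \<in> S \<longleftrightarrow> \<bar>t - t0\<bar> < d" for t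
    using d by (auto simp: S_def abs_if)
  have "((\<lambda>t. LINT x|M. f t x) has_real_derivative (LINT x|M. f' x)) (at t0 within S)"
    unfolding has_field_derivative_iff tendsto_at_iff_sequentially
  proof (intro allI impI)
    fix X :: "nat \<Rightarrow> real"
    assume X: "\<forall>i. X i \<in> S - {t0}" and lim: "X \<longlonglongrightarrow> t0"
    have Xd: "\<bar>X n - t0\<bar> < d" "X n \<noteq> t0" for n
      using X S_iff by auto
    have t0d: "\<bar>t0 - t0\<bar> < d" using d by simp
    have "(\<lambda>n. LINT x|M. (f (X n) x - f t0 x) / (X n - t0)) \<longlonglongrightarrow> (LINT x|M. f' x)"
    proof (rule integral_dominated_convergence[OF f' _ B])
      show "(\<lambda>x. (f (X n) x - f t0 x) / (X n - t0)) \<in> borel_measurable M" for n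
        using int[OF Xd(1)[of n]] int[OF t0d] by measurable
      show "AE x in M. (\<lambda>n. (f (X n) x - f t0 x) / (X n - t0)) \<longlonglongrightarrow> f' x"
        using deriv
      proof eventually_elim
        fix x assume "((\<lambda>t. f t x) has_real_derivative f' x) (at t0)"
        then have "((\<lambda>t. f t x) has_real_derivative f' x) (at t0 within S)"
          by (rule has_field_derivative_at_within)
        then show "(\<lambda>n. (f (X n) x - f t0 x) / (X n - t0)) \<longlonglongrightarrow> f' x"
          using X lim unfolding has_field_derivative_iff tendsto_at_iff_sequentially o_def by blast
      qed
      show "AE x in M. norm ((f (X n) x - f t0 x) / (X n - t0)) \<le> B x" for n
        using dom[OF Xd(1)[of n]] Xd(2)[of n] by (simp add: divide_le_eq)
    qed
    moreover have "(LINT x|M. (f (X n) x - f t0 x) / (X n - t0))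
        = ((LINT x|M. f (X n) x) - (LINT x|M. f t0 x)) / (X n - t0)" for n
      by (simp add: int[OF Xd(1)[of n]] int[OF t0d])
    ultimately show "((\<lambda>t. ((LINT x|M. f t x) - (LINT x|M. f t0 x)) / (t - t0)) \<circ> X)
        \<longlonglongrightarrow> (LINT x|M. f' x)"
      unfolding o_def by (simp only:)
  qed
  then show ?thesis
    using at_within_open[OF S(2,1)] by simp
qed

lemma real_mvt_bound:
  fixes f :: "real \<Rightarrow> real"
  assumes "\<And>t. t \<in> closed_segment a b \<Longrightarrow> (f has_real_derivative f' t) (at t)"
    and "\<And>t. t \<in> closed_segment a b \<Longrightarrow> \<bar>f' t\<bar> \<le> B"
  shows "\<bar>f b - f a\<bar> \<le> B * \<bar>b - a\<bar>"
  using field_differentiable_bound[of "closed_segment a b" f f' B b a] assms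
  by (auto intro: has_field_derivative_at_within)

text \<open>Partial derivatives are derivatives at parameter \<open>0\<close> of a line through the point; the
mean value theorem needs them at all parameters of one fixed line.\<close>

lemma has_real_derivative_along_line:
  fixes u :: "'a::real_normed_vector \<Rightarrow> real"
  assumes "((\<lambda>t. u ((y + s *\<^sub>R b) + t *\<^sub>R b)) has_real_derivative D) (at 0)"
  shows "((\<lambda>t. u (y + t *\<^sub>R b)) has_real_derivative D) (at s)"
proof -
  have "((\<lambda>t. u (y + (t + s) *\<^sub>R b)) has_real_derivative D) (at 0)"
    using assms by (simp add: algebra_simps)
  then show ?thesis
    using DERIV_shift[of "\<lambda>t. u (y + t *\<^sub>R b)" D 0 s] by simp
qed

text \<open>Continuity of the partial derivatives forces total differentiability: moving from \<open>x\<close> to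
\<open>x + h\<close> one coordinate at a time, each step is controlled by the mean value theorem.
The induction runs over the set of coordinates already moved.\<close>

lemma has_derivative_of_continuous_partials:
  fixes u :: "'a::euclidean_space \<Rightarrow> real"
  assumes S: "open S" "x \<in> S"
    and der: "\<And>b y. b \<in> Basis \<Longrightarrow> y \<in> S \<Longrightarrow>
                ((\<lambda>t. u (y + t *\<^sub>R b)) has_real_derivative g b y) (at 0)"
    and cont: "\<And>b. b \<in> Basis \<Longrightarrow> continuous_on S (g b)"
  shows "(u has_derivative (\<lambda>h. \<Sum>b\<in>Basis. (h \<bullet> b) * g b x)) (at x)"
proof -
  have main: "\<exists>d>0. \<forall>h. norm h < d \<longrightarrow>
       \<bar>u (x + (\<Sum>b\<in>T. (h \<bullet> b) *\<^sub>R b)) - u x - (\<Sum>b\<in>T. (h \<bullet> b) * g b x)\<bar> \<le> e * norm h"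
    if "finite T" "T \<subseteq> Basis" "e > 0" for T e
    using that
  proof (induction T arbitrary: e rule: finite_induct)
    case empty
    then show ?case by (auto intro!: exI[of _ 1])
  next
    case (insert c T)
    then have c: "c \<in> Basis" "norm c = 1" and e2: "e/2 > 0" and T: "T \<subseteq> Basis" by auto
    obtain d1 where d1: "d1 > 0" and d1': "\<And>h. norm h < d1 \<Longrightarrow>
        \<bar>u (x + (\<Sum>b\<in>T. (h \<bullet> b) *\<^sub>R b)) - u x - (\<Sum>b\<in>T. (h \<bullet> b) * g b x)\<bar> \<le> e/2 * norm h"
      using insert.IH[OF T e2] by auto
    have cc: "isCont (g c) x"
      using cont[OF c(1)] S continuous_on_eq_continuous_at by blast
    have "\<exists>d>0. \<forall>y. dist y x < d \<longrightarrow> \<bar>g c y - g c x\<bar> < e/2"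
      using iffD1[OF continuous_at_eps_delta cc, rule_format, OF e2] unfolding dist_real_def by this
    then obtain d2 where d2: "d2 > 0" and d2': "\<And>y. dist y x < d2 \<Longrightarrow> \<bar>g c y - g c x\<bar> < e/2"
      by blast
    obtain d3 where d3: "d3 > 0" "ball x d3 \<subseteq> S"
      using S openE by blast
    define N where "N = real (card T) + 1"
    have N: "N > 0" by (simp add: N_def)
    define d where "d = min d1 (min d2 d3 / N)"
    have "d > 0" using d1 d2 d3 N by (simp add: d_def)
    moreover have "\<bar>u (x + (\<Sum>b\<in>insert c T. (h \<bullet> b) *\<^sub>R b)) - u x
        - (\<Sum>b\<in>insert c T. (h \<bullet> b) * g b x)\<bar> \<le> e * norm h" if h: "norm h < d" for h
    proof -
      define y where "y = x + (\<Sum>b\<in>T. (h \<bullet> b) *\<^sub>R b)"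
      have hc: "\<bar>h \<bullet> c\<bar> \<le> norm h"
        using Basis_le_norm[OF c(1)] by simp
      have hN: "N * norm h < min d2 d3"
        using h N by (simp add: d_def field_simps)
      have near: "dist (y + s *\<^sub>R c) x < min d2 d3" if s: "s \<in> closed_segment 0 (h \<bullet> c)" for s
      proof -
        have "\<bar>s\<bar> \<le> \<bar>h \<bullet> c\<bar>"
          using s by (auto simp: closed_segment_eq_real_ivl split: if_splits)
        have "norm (\<Sum>b\<in>T. (h \<bullet> b) *\<^sub>R b) \<le> (\<Sum>b\<in>T. norm h)"
          using T by (intro sum_norm_le) (auto simp: Basis_le_norm subset_eq)
        then have "norm ((\<Sum>b\<in>T. (h \<bullet> b) *\<^sub>R b) + s *\<^sub>R c) \<le> real (card T) * norm h + \<bar>s\<bar>"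
          using c by (intro order_trans[OF norm_triangle_ineq]) simp
        also have "\<dots> \<le> N * norm h"
          using \<open>\<bar>s\<bar> \<le> \<bar>h \<bullet> c\<bar>\<close> hc by (simp add: N_def algebra_simps)
        finally show ?thesis
          using hN by (simp add: y_def dist_norm add.assoc)
      qed
      \<comment> \<open>Subtracting the linear part, the mean value theorem only sees the oscillation of the partial derivative near x.\<close>
      define \<phi> where "\<phi> s = u (y + s *\<^sub>R c) - s * g c x" for s
      have "\<bar>\<phi> (h \<bullet> c) - \<phi> 0\<bar> \<le> e/2 * \<bar>h \<bullet> c - 0\<bar>"
      proof (rule real_mvt_bound)
        fix s assume s: "s \<in> closed_segment 0 (h \<bullet> c)"
        have "y + s *\<^sub>R c \<in> S"
          using near[OF s] d3 by (auto simp: dist_commute)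
        then have "((\<lambda>s. u (y + s *\<^sub>R c)) has_real_derivative g c (y + s *\<^sub>R c)) (at s)"
          by (intro has_real_derivative_along_line[OF der[OF c(1)]])
        from DERIV_diff[OF this DERIV_cmult_Id[of "g c x"]]
        show "(\<phi> has_real_derivative (g c (y + s *\<^sub>R c) - g c x)) (at s)"
          by (simp add: \<phi>_def[abs_def] mult.commute)
        show "\<bar>g c (y + s *\<^sub>R c) - g c x\<bar> \<le> e/2"
          using d2'[of "y + s *\<^sub>R c"] near[OF s] by simp
      qed
      also have "\<dots> \<le> e/2 * norm h"
        using hc e2 by simp
      finally have 1: "\<bar>u (y + (h \<bullet> c) *\<^sub>R c) - u y - (h \<bullet> c) * g c x\<bar> \<le> e/2 * norm h"
        by (simp add: \<phi>_def algebra_simps)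
      have 2: "\<bar>u y - u x - (\<Sum>b\<in>T. (h \<bullet> b) * g b x)\<bar> \<le> e/2 * norm h"
        unfolding y_def using h by (intro d1') (simp add: d_def)
      have 3: "x + (\<Sum>b\<in>insert c T. (h \<bullet> b) *\<^sub>R b) = y + (h \<bullet> c) *\<^sub>R c"
        using insert.hyps by (simp add: y_def algebra_simps)
      show ?thesis
        unfolding 3 using 1 2 sum.insert[OF insert.hyps, of "\<lambda>b. (h \<bullet> b) * g b x"] by linarith
    qed
    ultimately show ?case by blast
  qed
  show ?thesis
    unfolding has_derivative_at_alt
  proof (intro conjI allI impI)
    show "bounded_linear (\<lambda>h. \<Sum>b\<in>Basis. (h \<bullet> b) * g b x)"
      by (intro bounded_linear_sum bounded_linear_mult_const bounded_linear_inner_left)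
    fix e :: real assume "e > 0"
    from main[OF finite_Basis order_refl this] obtain d where "d > 0" and d: "\<And>h. norm h < d \<Longrightarrow>
       \<bar>u (x + h) - u x - (\<Sum>b\<in>Basis. (h \<bullet> b) * g b x)\<bar> \<le> e * norm h"
      by (auto simp: euclidean_representation)
    have "norm (u y - u x - (\<Sum>b\<in>Basis. ((y - x) \<bullet> b) * g b x)) \<le> e * norm (y - x)"
      if "norm (y - x) < d" for y
      using d[OF that] by simp
    with \<open>d > 0\<close> show "\<exists>d>0. \<forall>y. norm (y - x) < d \<longrightarrow>
        norm (u y - u x - (\<Sum>b\<in>Basis. ((y - x) \<bullet> b) * g b x)) \<le> e * norm (y - x)"
      by blast
  qed
qed

section \<open>Weights on the unit ball and integration by parts\<close>

text \<open>These weights have two useful features: passing from \<open>k + 1\<close> to \<open>k\<close> is, up to a factor, one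
differentiation, and for positive exponent they tend to zero at the unit sphere, so that no
boundary term appears when integrating by parts.\<close>

definition bump :: "nat \<Rightarrow> 'a::euclidean_space \<Rightarrow> real" where
  "bump k z = (if norm z < 1 then (1 - (norm z)\<^sup>2) ^ k else 0)"

lemma bump_nonneg: "0 \<le> bump k z"
  and bump_le_1: "bump k z \<le> 1"
  by (auto simp: bump_def power_le_one abs_square_le_1 zero_le_power intro!: zero_le_power power_le_one)

lemma bump_eq_0: "norm z \<ge> 1 \<Longrightarrow> bump k z = 0"
  by (simp add: bump_def)

lemma bump_Suc: "bump (Suc k) z = bump k z * (1 - (norm z)\<^sup>2)"
  by (simp add: bump_def)

text \<open>Replacing \<open>norm z\<close> by \<open>min 1 (norm z)\<close> turns the cut-off power into a genuine power of a
Lipschitz function with values in the unit interval.\<close>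

lemma bump_Suc_lipschitz:
  fixes y z :: "'a::euclidean_space"
  shows "\<bar>bump (Suc k) y - bump (Suc k) z\<bar> \<le> 2 * real (Suc k) * norm (y - z)"
proof -
  \<comment> \<open>The function p is the weight with exponent 1, cut off at 0.\<close>
  define p where "p z = 1 - (min 1 (norm z))\<^sup>2" for z :: 'a
  have bp: "bump (Suc k) z = p z ^ Suc k" for z
    by (auto simp: bump_def p_def min_def not_less)
  have p1: "norm (p z) \<le> 1" for z
    by (auto simp: p_def abs_le_iff power_le_one)
  have "\<bar>p y - p z\<bar> = \<bar>min 1 (norm z) + min 1 (norm y)\<bar> * \<bar>min 1 (norm z) - min 1 (norm y)\<bar>"
    unfolding p_def abs_mult[symmetric] by (simp add: power2_eq_square algebra_simps)
  also have "\<dots> \<le> 2 * norm (y - z)"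
  proof (rule mult_mono)
    have "\<bar>norm y - norm z\<bar> \<le> norm (y - z)" by (rule norm_triangle_ineq3)
    then show "\<bar>min 1 (norm z) - min 1 (norm y)\<bar> \<le> norm (y - z)" by linarith
  qed (auto simp: min_def)
  finally have "\<bar>p y - p z\<bar> \<le> 2 * norm (y - z)" .
  have "\<bar>p y ^ Suc k - p z ^ Suc k\<bar> \<le> real (Suc k) * \<bar>p y - p z\<bar>"
    using norm_power_diff[where z="p y" and w="p z" and m="Suc k", OF p1 p1] unfolding real_norm_def by this
  then have "\<bar>p y ^ Suc k - p z ^ Suc k\<bar> \<le> real (Suc k) * (2 * norm (y - z))"
    by (intro order_trans[OF _ mult_left_mono[OF \<open>\<bar>p y - p z\<bar> \<le> 2 * norm (y - z)\<close>]]) simp_all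
  then show ?thesis
    unfolding bp by (simp only: mult_ac)
qed

lemma integrable_bump:
  fixes f :: "'a::euclidean_space \<Rightarrow> real"
  assumes "continuous_on (cball 0 1) f"
  shows "integrable lborel (\<lambda>z. bump k z * f z)"
proof -
  have cont: "continuous_on (ball 0 1) (\<lambda>z. (1 - (norm z)\<^sup>2) ^ k * f z)"
    using assms by (intro continuous_intros) (auto intro: continuous_on_subset)
  have eq: "bump k z * f z = indicator (ball 0 1) z *\<^sub>R ((1 - (norm z)\<^sup>2) ^ k * f z)" for z
    by (auto simp: bump_def indicator_def)
  obtain K where K: "\<And>z. z \<in> cball 0 1 \<Longrightarrow> norm (f z) \<le> K"
    using compact_imp_bounded[OF compact_continuous_image[OF assms compact_cball]]
    by (force simp: bounded_iff)
  show ?thesis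
  proof (rule integrableI_bounded_set[where A="ball 0 1" and B=K])
    show "(\<lambda>z. bump k z * f z) \<in> borel_measurable lborel"
      unfolding eq using borel_measurable_continuous_on_indicator[OF _ cont] by simp
    have "\<bar>bump k z * f z\<bar> \<le> K" if "z \<in> ball 0 1" for z
    proof -
      have "\<bar>bump k z\<bar> * \<bar>f z\<bar> \<le> 1 * K"
        using that K[of z] bump_le_1[of k z] bump_nonneg[of k z] by (intro mult_mono) auto
      then show ?thesis by (simp add: abs_mult)
    qed
    then show "AE x in lborel. x \<in> ball 0 1 \<longrightarrow> norm (bump k x * f x) \<le> K" by auto
  qed (auto simp: bump_def emeasure_ball)
qed

lemma AE_norm_neq_1: "AE z in lborel. norm (z::'a::euclidean_space) \<noteq> 1"
proof -
  have "sphere (0::'a) 1 \<in> null_sets lborel"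
    using negligible_sphere[of "0::'a" 1]
    by (simp add: null_sets_completion_iff negligible_iff_null_sets borel_closed)
  from AE_not_in[OF this] show ?thesis by simp
qed

lemma integral_lborel_translation:
  fixes f :: "'a::euclidean_space \<Rightarrow> real"
  assumes "f \<in> borel_measurable borel"
  shows "(LINT z|lborel. f (z + a)) = (LINT z|lborel. f z)"
proof -
  have "(LINT z|lborel. f z) = (LINT z|distr lborel borel ((+) a). f z)"
    by (simp add: lborel_distr_plus)
  also have "\<dots> = (LINT z|lborel. f (a + z))"
    using assms by (intro integral_distr) auto
  finally show ?thesis by (simp add: add.commute)
qed

lemma integral_lborel_dilation:
  fixes f :: "'a::euclidean_space \<Rightarrow> real"
  assumes "f \<in> borel_measurable borel" and "t > 0"
  shows "t ^ DIM('a) * (LINT z|lborel. f (t *\<^sub>R z)) = (LINT z|lborel. f z)"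
proof -
  have "(LINT z|lborel. f z)
      = (LINT z|density (distr lborel borel (\<lambda>z. 0 + t *\<^sub>R z)) (\<lambda>_. \<bar>t\<bar> ^ DIM('a)). f z)"
    using assms lborel_affine[of t "0::'a"] by simp
  also have "\<dots> = (LINT z|lborel. t ^ DIM('a) * f (t *\<^sub>R z))"
    using assms by (subst integral_density) (auto simp: integral_distr)
  finally show ?thesis by simp
qed


text \<open>A divergence theorem without boundary. The function \<open>F = bump (Suc k) * w\<close>, extended by zero,
is Lipschitz in direction \<open>b\<close>, so the integral of \<open>F (z + t *\<^sub>R b)\<close> may be differentiated in \<open>t\<close> under the
integral sign; by translation invariance it does not depend on \<open>t\<close>. Hence the integral of the
directional derivative of \<open>F\<close> is zero, and the product rule gives the formula.\<close>

lemma integral_bump_by_parts: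
  fixes w w' :: "'a::euclidean_space \<Rightarrow> real"
  assumes b: "b \<in> Basis" and e: "e > 0"
    and cw: "continuous_on (ball 0 (1 + e)) w" and cw': "continuous_on (ball 0 (1 + e)) w'"
    and der: "\<And>z. z \<in> ball 0 (1 + e) \<Longrightarrow> ((\<lambda>t. w (z + t *\<^sub>R b)) has_real_derivative w' z) (at 0)"
  shows "(LINT z|lborel. bump (Suc k) z * w' z)
       = 2 * real (Suc k) * (LINT z|lborel. bump k z * ((z \<bullet> b) * w z))"
proof -
  \<comment> \<open>Shifts shorter than d keep every segment with an endpoint in the unit ball inside the domain of w; the bound 1 makes the ball of radius 2 a common support.\<close>
  define d where "d = min (e/2) 1"
  have d: "d > 0" "d \<le> e/2" "d \<le> 1" using e by (auto simp: d_def)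
  have nb: "norm b = 1" using b by simp
  have sub: "cball (0::'a) 1 \<subseteq> ball 0 (1 + e)" "cball (0::'a) (1 + d) \<subseteq> ball 0 (1 + e)"
    using e d by auto
  obtain K where K: "K \<ge> 0" "\<And>z. norm z \<le> 1 + d \<Longrightarrow> \<bar>w z\<bar> \<le> K \<and> \<bar>w' z\<bar> \<le> K"
  proof -
    obtain K1 where "\<And>z. z \<in> cball 0 (1 + d) \<Longrightarrow> norm (w z) \<le> K1"
      using compact_imp_bounded[OF compact_continuous_image[OF continuous_on_subset[OF cw sub(2)] compact_cball]]
      by (force simp: bounded_iff)
    moreover obtain K2 where "\<And>z. z \<in> cball 0 (1 + d) \<Longrightarrow> norm (w' z) \<le> K2"
      using compact_imp_bounded[OF compact_continuous_image[OF continuous_on_subset[OF cw' sub(2)] compact_cball]]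
      by (force simp: bounded_iff)
    ultimately show ?thesis
      by (intro that[of "max 0 (max K1 K2)"]) (auto simp: le_max_iff_disj)
  qed
  define F where "F z = bump (Suc k) z * w z" for z
  define F' where "F' z = bump (Suc k) z * w' z - 2 * real (Suc k) * (bump k z * ((z \<bullet> b) * w z))" for z
  have intF: "integrable lborel F"
    unfolding F_def by (rule integrable_bump[OF continuous_on_subset[OF cw sub(1)]])
  then have measF: "F \<in> borel_measurable borel" by auto
  have int1: "integrable lborel (\<lambda>z. bump (Suc k) z * w' z)"
    by (rule integrable_bump[OF continuous_on_subset[OF cw' sub(1)]])
  have int2: "integrable lborel (\<lambda>z. bump k z * ((z \<bullet> b) * w z))"
    using continuous_on_subset[OF cw sub(1)] by (intro integrable_bump continuous_intros)
  have intF': "integrable lborel F'"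
    unfolding F'_def using int1 int2 by auto
  have const: "(LINT z|lborel. F (z + t *\<^sub>R b)) = (LINT z|lborel. F z)" for t
    by (rule integral_lborel_translation[OF measF])
  have "((\<lambda>t. LINT z|lborel. F (z + t *\<^sub>R b)) has_real_derivative (LINT z|lborel. F' z)) (at 0)"
  proof (rule has_real_derivative_under_integral[OF d(1), where
        B = "\<lambda>z. indicator (cball 0 2) z *\<^sub>R ((2 * real (Suc k) + 1) * K)"])
    have "integrable (distr lborel borel ((+) (t *\<^sub>R b))) F" for t
      using intF by (simp add: lborel_distr_plus)
    then show "integrable lborel (\<lambda>z. F (z + t *\<^sub>R b))" for t
      using integrable_distr[of "(+) (t *\<^sub>R b)" lborel borel F] by (simp add: add.commute)
    show "F' \<in> borel_measurable lborel"
      using intF' by auto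
    show "integrable lborel (\<lambda>z::'a. indicator (cball 0 2) z *\<^sub>R ((2 * real (Suc k) + 1) * K))"
      by (intro integrableI_bounded_set_indicator[where B="(2 * real (Suc k) + 1) * K"])
        (auto simp: emeasure_cball K(1))
    show "AE z in lborel. ((\<lambda>t. F (z + t *\<^sub>R b)) has_real_derivative F' z) (at 0)"
      using AE_norm_neq_1
    proof eventually_elim
      fix z :: 'a assume "norm z \<noteq> 1"
      then consider "norm z < 1" | "norm z > 1" by linarith
      then show "((\<lambda>t. F (z + t *\<^sub>R b)) has_real_derivative F' z) (at 0)"
      proof cases
        case 1
        have sq: "(norm (z + t *\<^sub>R b))\<^sup>2 = (norm z)\<^sup>2 + 2 * t * (z \<bullet> b) + t\<^sup>2" for t
          unfolding power2_norm_eq_inner using inner_same_Basis[OF b]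
          by (simp add: inner_add_left inner_add_right inner_commute power2_eq_square)
        have "z \<in> ball 0 (1 + e)" using 1 e by simp
        from der[OF this]
        have "((\<lambda>t. (1 - ((norm z)\<^sup>2 + 2 * t * (z \<bullet> b) + t\<^sup>2)) ^ Suc k * w (z + t *\<^sub>R b))
            has_real_derivative F' z) (at 0)"
          using 1
          by (auto intro!: derivative_eq_intros simp: F'_def bump_def simp del: power_Suc)
        moreover have "open {t. norm (z + t *\<^sub>R b) < 1}"
          by (intro open_Collect_less continuous_intros)
        ultimately show ?thesis
          by (rule has_field_derivative_transform_within_open)
            (use 1 in \<open>auto simp: F_def bump_def sq simp del: power_Suc\<close>)
      next
        case 2
        have "open {t. norm (z + t *\<^sub>R b) > 1}"
          by (intro open_Collect_less continuous_intros)
        then have "((\<lambda>t. F (z + t *\<^sub>R b)) has_real_derivative 0) (at 0)"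
          by (rule has_field_derivative_transform_within_open[OF DERIV_const])
            (use 2 in \<open>auto simp: F_def bump_def\<close>)
        then show ?thesis using 2 by (simp add: F'_def bump_def)
      qed
    qed
    show "\<bar>F (z + t *\<^sub>R b) - F (z + 0 *\<^sub>R b)\<bar>
        \<le> indicator (cball 0 2) z *\<^sub>R ((2 * real (Suc k) + 1) * K) * \<bar>t - 0\<bar>"
      if t: "\<bar>t - 0\<bar> < d" for t z
    proof -
      define y where "y = z + t *\<^sub>R b"
      have yz: "norm (y - z) = \<bar>t\<bar>" using nb by (simp add: y_def)
      show ?thesis
      proof (cases "norm z \<ge> 1 \<and> norm y \<ge> 1")
        case True
        then show ?thesis
          using K(1) by (auto simp: F_def bump_eq_0 y_def)
      next
        case False
        have seg: "norm (z + s *\<^sub>R b) \<le> 1 + d" if s: "s \<in> closed_segment 0 t" for s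
        proof -
          have "\<bar>s\<bar> \<le> \<bar>t\<bar>" "\<bar>s - t\<bar> \<le> \<bar>t\<bar>"
            using s by (auto simp: closed_segment_eq_real_ivl split: if_splits)
          moreover have "norm (z + s *\<^sub>R b) \<le> norm z + \<bar>s\<bar>"
            using norm_triangle_ineq[of z "s *\<^sub>R b"] nb by simp
          moreover have "z + s *\<^sub>R b = y + (s - t) *\<^sub>R b"
            by (simp add: y_def algebra_simps)
          then have "norm (z + s *\<^sub>R b) \<le> norm y + \<bar>s - t\<bar>"
            using norm_triangle_ineq[of y "(s - t) *\<^sub>R b"] nb by simp
          ultimately show ?thesis using False t by linarith
        qed
        have z2: "norm z \<le> 2" "norm z \<le> 1 + d" "norm y \<le> 1 + d"
          using seg[of 0] seg[of t] d by (auto simp: y_def)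
        have w: "\<bar>w y - w z\<bar> \<le> K * \<bar>t\<bar>"
        proof -
          have "\<bar>w (z + t *\<^sub>R b) - w (z + 0 *\<^sub>R b)\<bar> \<le> K * \<bar>t - 0\<bar>"
          proof (rule real_mvt_bound)
            fix s assume s: "s \<in> closed_segment 0 t"
            have "z + s *\<^sub>R b \<in> ball 0 (1 + e)"
              using seg[OF s] sub(2) by auto
            then show "((\<lambda>s. w (z + s *\<^sub>R b)) has_real_derivative w' (z + s *\<^sub>R b)) (at s)"
              by (intro has_real_derivative_along_line[OF der])
            show "\<bar>w' (z + s *\<^sub>R b)\<bar> \<le> K"
              using K(2)[OF seg[OF s]] by simp
          qed
          then show ?thesis by (simp add: y_def)
        qed
        have "F y - F z = bump (Suc k) y * (w y - w z) + (bump (Suc k) y - bump (Suc k) z) * w z"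
          by (simp add: F_def algebra_simps)
        also have "\<bar>\<dots>\<bar> \<le> \<bar>bump (Suc k) y\<bar> * \<bar>w y - w z\<bar> + \<bar>bump (Suc k) y - bump (Suc k) z\<bar> * \<bar>w z\<bar>"
          unfolding abs_mult[symmetric] by (rule abs_triangle_ineq)
        also have "\<dots> \<le> 1 * (K * \<bar>t\<bar>) + (2 * real (Suc k) * \<bar>t\<bar>) * K"
          using w K(2)[OF z2(2)] K(1) bump_le_1[of "Suc k" y] bump_nonneg[of "Suc k" y]
            bump_Suc_lipschitz[of k y z] yz
          by (intro add_mono mult_mono) auto
        finally show ?thesis
          using z2 by (simp add: y_def algebra_simps)
      qed
    qed
  qed
  then have "(LINT z|lborel. F' z) = 0"
    unfolding const using DERIV_const DERIV_unique by blast
  moreover have "(LINT z|lborel. F' z) = (LINT z|lborel. bump (Suc k) z * w' z)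
      - 2 * real (Suc k) * (LINT z|lborel. bump k z * ((z \<bullet> b) * w z))"
    unfolding F'_def
    by (simp only: Bochner_Integration.integral_diff[OF int1 integrable_mult_right[OF int2]]
        integral_mult_right_zero)
  ultimately show ?thesis by simp
qed

definition bump_integral :: "('a::euclidean_space) itself \<Rightarrow> nat \<Rightarrow> real" where
  "bump_integral _ k = (LINT z|lborel. bump k (z::'a))"

text \<open>Integration by parts with the coordinate field \<open>w z = z \<bullet> b\<close>, summed over \<open>b\<close>; here
\<open>bump k z * (norm z)\<^sup>2 = bump k z - bump (Suc k) z\<close>. Together with the volume of the unit
ball this determines all these integrals.\<close>

lemma bump_integral_Suc:
  "(real DIM('a) / 2 + real k + 1) * bump_integral TYPE('a::euclidean_space) (Suc k)
     = (real k + 1) * bump_integral TYPE('a) k"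
proof -
  have int: "integrable lborel (bump k :: 'a \<Rightarrow> real)" for k
    using integrable_bump[of "\<lambda>_. 1::real" k] by simp
  have int': "integrable lborel (\<lambda>z::'a. bump k z * ((z \<bullet> b) * (z \<bullet> b)))" for b
    by (intro integrable_bump continuous_intros)
  have "real DIM('a) * (LINT z|lborel. bump (Suc k) (z::'a))
      = (\<Sum>b\<in>(Basis::'a set). LINT z|lborel. bump (Suc k) (z::'a) * 1)"
    by simp
  also have "\<dots> = (\<Sum>b\<in>(Basis::'a set). 2 * real (Suc k) * (LINT z|lborel. bump k z * ((z \<bullet> b) * (z \<bullet> b))))"
  proof (rule sum.cong[OF refl], rule integral_bump_by_parts[where e=1])
    fix b z :: 'a assume "b \<in> Basis"
    then show "((\<lambda>t. (z + t *\<^sub>R b) \<bullet> b) has_real_derivative 1) (at 0)"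
      by (auto intro!: derivative_eq_intros simp: inner_add_left)
  qed (auto intro!: continuous_intros)
  also have "\<dots> = 2 * real (Suc k) * (LINT z|lborel. (\<Sum>b\<in>(Basis::'a set). bump k z * ((z \<bullet> b) * (z \<bullet> b))))"
    using int' by (simp add: sum_distrib_left)
  also have "(\<lambda>z::'a. \<Sum>b\<in>(Basis::'a set). bump k z * ((z \<bullet> b) * (z \<bullet> b))) = (\<lambda>z. bump k z - bump (Suc k) z)"
  proof
    fix z :: 'a
    have "(\<Sum>b\<in>(Basis::'a set). (z \<bullet> b) * (z \<bullet> b)) = (norm z)\<^sup>2"
      unfolding power2_norm_eq_inner by (rule euclidean_inner[symmetric])
    then show "(\<Sum>b\<in>(Basis::'a set). bump k z * ((z \<bullet> b) * (z \<bullet> b))) = bump k z - bump (Suc k) z"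
      unfolding sum_distrib_left[symmetric] bump_Suc by (simp add: right_diff_distrib)
  qed
  finally show ?thesis
    using int by (simp add: bump_integral_def algebra_simps)
qed

lemma bump_integral_0: "bump_integral TYPE('a::euclidean_space) 0 = unit_ball_vol (real DIM('a))"
proof -
  have "bump 0 = (indicator (ball 0 1) :: 'a \<Rightarrow> real)"
    by (auto simp: bump_def indicator_def fun_eq_iff)
  then show ?thesis
    by (simp add: bump_integral_def measure_def emeasure_ball)
qed

lemma bump_integral_eq:
  "bump_integral TYPE('a::euclidean_space) k
     = pi powr (real DIM('a) / 2) * fact k / Gamma (real k + real DIM('a) / 2 + 1)"
proof (induction k)
  case 0
  then show ?case by (simp add: bump_integral_0 unit_ball_vol_def add.commute)
next
  case (Suc k)
  define m where "m = real DIM('a) / 2"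
  have m: "m > 0" by (simp add: m_def)
  have G: "Gamma (real (Suc k) + m + 1) = (real k + m + 1) * Gamma (real k + m + 1)"
  proof -
    have "real k + m + 1 \<notin> \<int>\<^sub>\<le>\<^sub>0"
      using m by (auto dest: nonpos_Ints_nonpos)
    from Gamma_plus1[OF this] show ?thesis by (simp add: ac_simps)
  qed
  have G0: "Gamma (real k + m + 1) > 0" using m by (intro Gamma_real_pos) simp
  have "(m + real k + 1) * bump_integral TYPE('a) (Suc k) = (real k + 1) * bump_integral TYPE('a) k"
    using bump_integral_Suc[where 'a='a, of k] by (simp add: m_def)
  then have "bump_integral TYPE('a) (Suc k) = (real k + 1) * bump_integral TYPE('a) k / (real k + m + 1)"
    using m by (simp add: field_simps)
  then show ?case
    using G0 m unfolding Suc.IH m_def[symmetric] G by (simp add: algebra_simps)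
qed

section \<open>Taylor expansion of a chain of derivatives\<close>

text \<open>In the variable \<open>q = (c * t / 2)\<^sup>2\<close> the hypothesis says that the derivative of \<open>P k\<close> is
\<open>P (Suc k)\<close> divided by \<open>k + 1\<close>. So the \<open>n\<close>-th derivative of \<open>P k\<close> is
\<open>P (k + n)\<close> times \<open>k! / (k + n)!\<close>, and the series is the Taylor series at \<open>q = 0\<close>. A bound
on all \<open>P k\<close> that is uniform in \<open>k\<close> makes the remainder of order \<open>N\<close> at most
\<open>K * q ^ N / N!\<close>. Working with \<open>t\<close> in place of \<open>q\<close> avoids one-sided derivatives at \<open>0\<close>.\<close>

lemma iterated_derivative_series:
  fixes P :: "nat \<Rightarrow> real \<Rightarrow> real" and c :: real
  assumes der: "\<And>k t. 0 \<le> t \<Longrightarrow> t \<le> R \<Longrightarrow>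
      (P k has_real_derivative c\<^sup>2 * t / (2 * real (Suc k)) * P (Suc k) t) (at t)"
    and bound: "\<And>k t. 0 \<le> t \<Longrightarrow> t \<le> R \<Longrightarrow> \<bar>P k t\<bar> \<le> K"
    and R: "R \<ge> 0"
  shows "(\<lambda>n. P (k + n) 0 * fact k / (fact n * fact (k + n)) * (c * R / 2) ^ (2 * n)) sums P k R"
proof -
  define T where "T k n t = P (k + n) 0 * fact k / (fact n * fact (k + n)) * (c * t / 2) ^ (2 * n)" for k n t
  have K: "K \<ge> 0" using bound[of 0 0] R by auto
  have T_Suc: "(T k (Suc n) has_real_derivative c\<^sup>2 * t / (2 * real (Suc k)) * T (Suc k) n t) (at t)" for k n t
  proof -
    define a where "a = P (k + Suc n) 0 * fact k / (fact (Suc n) * fact (k + Suc n))"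
    have "((\<lambda>t. (c * t / 2)\<^sup>2) has_real_derivative c\<^sup>2 * t / 2) (at t)"
      by (auto intro!: derivative_eq_intros simp: power2_eq_square)
    from DERIV_power[OF this, of "Suc n"]
    have "((\<lambda>t. a * ((c * t / 2)\<^sup>2) ^ Suc n) has_real_derivative
        a * (real (Suc n) * (c\<^sup>2 * t / 2 * ((c * t / 2)\<^sup>2) ^ n))) (at t)"
      by (intro DERIV_cmult) simp
    also have "a * (real (Suc n) * (c\<^sup>2 * t / 2 * ((c * t / 2)\<^sup>2) ^ n))
        = c\<^sup>2 * t / 2 * (a * real (Suc n)) * ((c * t / 2)\<^sup>2) ^ n"
      by (simp only: mult_ac)
    also have "\<dots> = c\<^sup>2 * t / (2 * real (Suc k)) * T (Suc k) n t"
    proof -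
      define X where "X = P (Suc k + n) 0 * fact (Suc k) / (fact n * fact (Suc k + n))"
      have aX: "a * real (Suc n) = X / real (Suc k)"
        by (simp add: a_def X_def divide_simps del: of_nat_Suc)
      have "T (Suc k) n t = X * ((c * t / 2)\<^sup>2) ^ n"
        by (simp only: T_def X_def power_mult)
      then show ?thesis
        unfolding aX by (simp del: of_nat_Suc)
    qed
    finally have "((\<lambda>t. a * ((c * t / 2)\<^sup>2) ^ Suc n) has_real_derivative
        c\<^sup>2 * t / (2 * real (Suc k)) * T (Suc k) n t) (at t)" .
    then show ?thesis
      by (simp only: T_def[abs_def] a_def power_mult)
  qed
  have main: "\<bar>P k t - (\<Sum>n<N. T k n t)\<bar> \<le> K * ((c * t / 2)\<^sup>2) ^ N / fact N"
    if "0 \<le> t" "t \<le> R" for N k t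
    using that
  proof (induction N arbitrary: k t)
    case 0
    then show ?case using bound by simp
  next
    case (Suc N)
    define D where "D t = P k t - (\<Sum>n<Suc N. T k n t)" for t
    define E where "E t = K * ((c * t / 2)\<^sup>2) ^ Suc N / fact (Suc N)" for t
    define D' where "D' t = c\<^sup>2 * t / (2 * real (Suc k)) * (P (Suc k) t - (\<Sum>n<N. T (Suc k) n t))" for t
    define E' where "E' t = c\<^sup>2 * t / 2 * (K * ((c * t / 2)\<^sup>2) ^ N / fact N)" for t
    \<comment> \<open>The first term of the sum is the constant P k 0, so differentiating lowers the order of the remainder by one.\<close>
    have D_alt: "D = (\<lambda>t. P k t - (P k 0 + (\<Sum>n<N. T k (Suc n) t)))"
      by (simp only: D_def[abs_def] sum.lessThan_Suc_shift) (simp add: T_def)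
    have dD: "(D has_real_derivative D' s) (at s)" if "0 \<le> s" "s \<le> R" for s
      unfolding D_alt D'_def
      using der[OF that, of k] T_Suc
      by (auto intro!: derivative_eq_intros simp: right_diff_distrib sum_distrib_left)
    have dE: "(E has_real_derivative E' s) (at s)" for s
    proof -
      have "((\<lambda>t. (c * t / 2)\<^sup>2) has_real_derivative c\<^sup>2 * s / 2) (at s)"
        by (auto intro!: derivative_eq_intros simp: power2_eq_square)
      from DERIV_power[OF this, of "Suc N"]
      have "((\<lambda>t. K / fact (Suc N) * ((c * t / 2)\<^sup>2) ^ Suc N) has_real_derivative
          K / fact (Suc N) * (real (Suc N) * (c\<^sup>2 * s / 2 * ((c * s / 2)\<^sup>2) ^ N))) (at s)"
        by (intro DERIV_cmult) simp
      also have "K / fact (Suc N) * (real (Suc N) * (c\<^sup>2 * s / 2 * ((c * s / 2)\<^sup>2) ^ N)) = E' s"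
        by (simp add: E'_def mult_ac)
      finally show ?thesis
        by (simp add: E_def[abs_def])
    qed
    have le: "\<bar>D' s\<bar> \<le> E' s" if "0 \<le> s" "s \<le> R" for s
    proof -
      have "\<bar>D' s\<bar> = c\<^sup>2 * s / (2 * real (Suc k)) * \<bar>P (Suc k) s - (\<Sum>n<N. T (Suc k) n s)\<bar>"
        using that by (simp add: D'_def abs_mult)
      also have "\<dots> \<le> c\<^sup>2 * s / 2 * (K * ((c * s / 2)\<^sup>2) ^ N / fact N)"
      proof (rule mult_mono)
        show "c\<^sup>2 * s / (2 * real (Suc k)) \<le> c\<^sup>2 * s / 2"
          using that by (intro divide_left_mono) auto
        show "0 \<le> c\<^sup>2 * s / 2" using that by simp
      qed (use Suc.IH[OF that, of "Suc k"] in auto)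
      finally show ?thesis by (simp add: E'_def)
    qed
    \<comment> \<open>With a sign in front of D this gives both one-sided estimates.\<close>
    have mono: "(\<lambda>s. E s + \<sigma> * D s) 0 \<le> (\<lambda>s. E s + \<sigma> * D s) t" if \<sigma>: "\<bar>\<sigma>\<bar> = 1" for \<sigma>
    proof (rule DERIV_nonneg_imp_nondecreasing[OF Suc.prems(1)])
      fix s assume s: "0 \<le> s" "s \<le> t"
      have "((\<lambda>s. E s + \<sigma> * D s) has_real_derivative E' s + \<sigma> * D' s) (at s)"
        using s Suc.prems by (auto intro!: derivative_eq_intros dE dD)
      moreover have "\<bar>\<sigma> * D' s\<bar> \<le> E' s"
        using le[of s] s Suc.prems \<sigma> by (simp add: abs_mult)
      ultimately show "\<exists>y. ((\<lambda>s. E s + \<sigma> * D s) has_real_derivative y) (at s) \<and> 0 \<le> y"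
        by (intro exI[of _ "E' s + \<sigma> * D' s"]) auto
    qed
    have "D 0 = 0" unfolding D_alt by (simp add: T_def)
    moreover have "E 0 = 0" by (simp add: E_def)
    ultimately have "\<bar>D t\<bar> \<le> E t" using mono[of 1] mono[of "-1"] by simp
    then show ?case by (simp only: D_def E_def)
  qed
  have "(\<lambda>N. K * (inverse (fact N) * ((c * R / 2)\<^sup>2) ^ N)) \<longlonglongrightarrow> K * 0"
    by (intro tendsto_mult tendsto_const summable_LIMSEQ_zero[OF summable_exp])
  then have lim: "(\<lambda>N. K * ((c * R / 2)\<^sup>2) ^ N / fact N) \<longlonglongrightarrow> 0"
    by (simp only: divide_inverse mult_ac mult_zero_right mult_zero_left)
  have "(\<lambda>N. (\<Sum>n<N. T k n R) - P k R) \<longlonglongrightarrow> 0"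
    by (rule Lim_null_comparison[OF _ lim])
      (use main[OF R order_refl, of k] in \<open>simp add: abs_minus_commute\<close>)
  then have "(\<lambda>N. (\<Sum>n<N. T k n R)) \<longlonglongrightarrow> P k R"
    by (rule LIM_zero_cancel)
  then show ?thesis
    by (simp add: sums_def T_def)
qed

section \<open>Sphere integrals as ball integrals\<close>

text \<open>The sphere integral is by construction an integral over the punctured unit ball of a function
that is constant along rays.\<close>

lemma integral_sphere_area:
  fixes f :: "'a::euclidean_space \<Rightarrow> real"
  assumes "continuous_on (sphere 0 1) f"
  shows "(LINT y|sphere_area. f y)
       = real DIM('a) * (LINT z|lborel. indicator (ball 0 1 - {0}) z *\<^sub>R f (z /\<^sub>R norm z))"
proof -
  define M where "M = distr (restrict_space lborel (ball (0::'a) 1 - {0}))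
            (restrict_space borel (sphere 0 1)) (\<lambda>x. x /\<^sub>R norm x)"
  have meas: "f \<in> borel_measurable (restrict_space borel (sphere 0 1))"
    using assms by (rule borel_measurable_continuous_on_restrict)
  then have measM: "f \<in> borel_measurable M"
    by (simp add: M_def)
  have eq: "(sphere_area :: 'a measure) = density M (\<lambda>_. ennreal (real DIM('a)))"
    by (rule measure_eqI)
      (auto simp: sphere_area_def M_def emeasure_density_const ennreal_of_nat_eq_real_of_nat)
  have "(LINT y|sphere_area. f y) = (LINT y|M. real DIM('a) * f y)"
    unfolding eq using measM by (subst integral_density) auto
  also have "\<dots> = real DIM('a) * (LINT y|M. f y)" by simp
  also have "(LINT y|M. f y) = (LINT z|restrict_space lborel (ball (0::'a) 1 - {0}). f (z /\<^sub>R norm z))"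
    unfolding M_def by (rule integral_distr[OF cone_projection_measurable meas])
  also have "\<dots> = (LINT z|lborel. indicator (ball 0 1 - {0}) z *\<^sub>R f (z /\<^sub>R norm z))"
    by (rule integral_restrict_space) simp
  finally show ?thesis .
qed

text \<open>This is the divergence theorem for the field \<open>U z *\<^sub>R z\<close> on the unit ball, with \<open>V\<close> the radial
derivative \<open>z \<bullet> \<nabla>U z\<close>. Instead of translations, dilations are used: subtract from \<open>U\<close> its
radially constant extension from the sphere. The difference \<open>F\<close>, cut off at the sphere, is
Lipschitz along rays. The integral of \<open>F (t *\<^sub>R z)\<close> is \<open>t\<close> to the power minus the dimension times
the integral of \<open>F\<close>, and comparing derivatives at \<open>t = 1\<close> gives the claim, because the
radially constant part does not contribute to the radial derivative.\<close>

lemma sphere_integral_eq_ball_integrals: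
  fixes U V :: "'a::euclidean_space \<Rightarrow> real"
  assumes e: "e > 0"
    and cU: "continuous_on (ball 0 (1 + e)) U" and cV: "continuous_on (ball 0 (1 + e)) V"
    and der: "\<And>z. z \<in> ball 0 (1 + e) \<Longrightarrow> ((\<lambda>t. U (t *\<^sub>R z)) has_real_derivative V z) (at 1)"
  shows "(LINT y|sphere_area. U y)
       = real DIM('a) * (LINT z|lborel. bump 0 z * U z) + (LINT z|lborel. bump 0 z * V z)"
proof -
  have sub: "cball (0::'a) 1 \<subseteq> ball 0 (1 + e)" using e by auto
  have cU1: "continuous_on (cball 0 1) U" and cV1: "continuous_on (cball 0 1) V"
    using cU cV sub by (auto intro: continuous_on_subset)
  obtain K where K: "K \<ge> 0" "\<And>z. norm z \<le> 1 \<Longrightarrow> \<bar>U z\<bar> \<le> K" "\<And>z. norm z \<le> 1 \<Longrightarrow> \<bar>V z\<bar> \<le> K"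
  proof -
    obtain K1 where "\<And>z. z \<in> cball 0 1 \<Longrightarrow> norm (U z) \<le> K1"
      using compact_imp_bounded[OF compact_continuous_image[OF cU1 compact_cball]]
      by (force simp: bounded_iff)
    moreover obtain K2 where "\<And>z. z \<in> cball 0 1 \<Longrightarrow> norm (V z) \<le> K2"
      using compact_imp_bounded[OF compact_continuous_image[OF cV1 compact_cball]]
      by (force simp: bounded_iff)
    ultimately show ?thesis
      by (intro that[of "max 0 (max K1 K2)"]) (auto simp: le_max_iff_disj)
  qed
  define W where "W z = U (z /\<^sub>R norm z)" for z
  define F where "F z = indicator (ball 0 1 - {0}) z *\<^sub>R (U z - W z)" for z
  have cW: "continuous_on (ball 0 1 - {0}) W"
    unfolding W_def
  proof (rule continuous_on_compose2[OF cU1])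
    have "norm (z /\<^sub>R norm z) \<le> 1" if "z \<noteq> 0" for z :: 'a
      using that by simp
    then show "(\<lambda>z::'a. z /\<^sub>R norm z) ` (ball 0 1 - {0}) \<subseteq> cball 0 1"
      by (intro image_subsetI) (simp only: mem_cball_0 Diff_iff singleton_iff not_False_eq_True)
  qed (auto intro!: continuous_intros)
  have cU0: "continuous_on (ball 0 1 - {0}) U"
    by (rule continuous_on_subset[OF cU1]) auto
  have W_le: "\<bar>W z\<bar> \<le> K" if "z \<noteq> 0" for z
    unfolding W_def using that by (intro K(2)) simp
  have fin: "emeasure lborel (ball (0::'a) 1 - {0}) < \<infinity>"
    by (rule le_less_trans[OF emeasure_mono[of _ "ball 0 1"]]) (auto simp: emeasure_ball)
  have measF: "F \<in> borel_measurable borel"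
    unfolding F_def
    by (intro borel_measurable_continuous_on_indicator continuous_intros cU0 cW) auto
  have F_le: "\<bar>F z\<bar> \<le> 2 * K" for z
    using K(1) K(2)[of z] W_le[of z] by (auto simp: F_def indicator_def)
  have intW: "integrable lborel (\<lambda>z. indicator (ball 0 1 - {0}) z *\<^sub>R W z)"
  proof (rule integrableI_bounded_set[where A="ball 0 1 - {0}" and B=K])
    show "(\<lambda>z. indicator (ball 0 1 - {0}) z *\<^sub>R W z) \<in> borel_measurable lborel"
      using borel_measurable_continuous_on_indicator[OF _ cW] by simp
  qed (use W_le fin in auto)
  have intU: "integrable lborel (\<lambda>z. bump 0 z * U z)" and intV: "integrable lborel (\<lambda>z. bump 0 z * V z)"
    using cU1 cV1 by (auto intro: integrable_bump)
  have neq0: "AE z in lborel. z \<noteq> (0::'a)"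
    by (rule AE_lborel_singleton)
  have ray: "((\<lambda>s. U (s *\<^sub>R z)) has_real_derivative V (t *\<^sub>R z) / t) (at t)"
    if t: "t > 0" "norm (t *\<^sub>R z) \<le> 1" for t z
  proof -
    have "((\<lambda>s. U (s *\<^sub>R (t *\<^sub>R z))) has_real_derivative V (t *\<^sub>R z)) (at (t / t))"
      using der[of "t *\<^sub>R z"] t e by simp
    from DERIV_chain2[OF this DERIV_cdivide[OF DERIV_ident]]
    show ?thesis using t by simp
  qed
  \<comment> \<open>Along the ray through z the cut-off function stops at the sphere, which is reached at parameter 1 / norm z. This formula makes the Lipschitz bound independent of the position of z.\<close>
  have F_ray: "F (t *\<^sub>R z) = U (min t (1 / norm z) *\<^sub>R z) - U ((1 / norm z) *\<^sub>R z)"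
    if "z \<noteq> 0" "t > 0" for t z
  proof (cases "t < 1 / norm z")
    case True
    then have "t *\<^sub>R z \<in> ball 0 1 - {0}" "W (t *\<^sub>R z) = U ((1 / norm z) *\<^sub>R z)"
      using that by (auto simp: field_simps W_def)
    then show ?thesis using True by (simp add: F_def)
  next
    case False
    then have "norm (t *\<^sub>R z) \<ge> 1" using that by (simp add: field_simps)
    then show ?thesis using False by (auto simp: F_def indicator_def min_def)
  qed
  define I where "I = (LINT z|lborel. F z)"
  have "((\<lambda>t. LINT z|lborel. F (t *\<^sub>R z)) has_real_derivative (LINT z|lborel. bump 0 z * V z)) (at 1)"
  proof (rule has_real_derivative_under_integral[where d="1/2" and B = "\<lambda>z. indicator (cball 0 2) z *\<^sub>R (2 * K)"])
    have out: "F (t *\<^sub>R z) = 0" if "t > 1/2" "norm z \<ge> 2" for t z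
    proof -
      have "1/2 * 2 \<le> t * norm z" using that by (intro mult_mono) auto
      then show ?thesis using that by (simp add: F_def indicator_def)
    qed
    show "integrable lborel (\<lambda>z. F (t *\<^sub>R z))" if "\<bar>t - 1\<bar> < 1/2" for t
    proof (rule integrableI_bounded_set[where A="cball 0 2" and B="2 * K"])
      show "(\<lambda>z. F (t *\<^sub>R z)) \<in> borel_measurable lborel"
        using measF by simp
      have "t > 1/2" using that by (auto simp: abs_if split: if_splits)
      then show "AE z in lborel. z \<notin> cball 0 2 \<longrightarrow> F (t *\<^sub>R z) = 0"
        by (auto intro!: out)
    qed (use F_le in \<open>auto simp: emeasure_cball\<close>)
    show "(\<lambda>z. bump 0 z * V z) \<in> borel_measurable lborel"
      using intV by auto
    show "integrable lborel (\<lambda>z::'a. indicator (cball 0 2) z *\<^sub>R (2 * K))"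
      by (intro integrableI_bounded_set_indicator[where B="2 * K"])
        (auto simp: emeasure_cball K(1))
    show "AE z in lborel. ((\<lambda>t. F (t *\<^sub>R z)) has_real_derivative bump 0 z * V z) (at 1)"
      using AE_norm_neq_1 neq0
    proof eventually_elim
      fix z :: 'a assume z: "norm z \<noteq> 1" "z \<noteq> 0"
      define \<tau> where "\<tau> = 1 / norm z"
      have Ft: "F (t *\<^sub>R z) = U (min t \<tau> *\<^sub>R z) - U (\<tau> *\<^sub>R z)" if "t > 0" for t
        using F_ray[OF z(2) that] by (simp add: \<tau>_def)
      consider "norm z < 1" | "norm z > 1" using z by linarith
      then show "((\<lambda>t. F (t *\<^sub>R z)) has_real_derivative bump 0 z * V z) (at 1)"
      proof cases
        case 1
        then have "\<tau> > 1" using z by (simp add: \<tau>_def)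
        have "((\<lambda>t. U (t *\<^sub>R z) - U (\<tau> *\<^sub>R z)) has_real_derivative V z - 0) (at 1)"
          using der[of z] 1 e by (intro DERIV_diff DERIV_const) auto
        then have "((\<lambda>t. F (t *\<^sub>R z)) has_real_derivative V z - 0) (at 1)"
          by (rule has_field_derivative_transform_within_open[where S="{0<..<\<tau>}"])
            (use \<open>\<tau> > 1\<close> Ft in auto)
        then show ?thesis using 1 by (simp add: bump_def)
      next
        case 2
        then have "\<tau> < 1" "\<tau> > 0" using z by (auto simp: \<tau>_def)
        have "((\<lambda>t. F (t *\<^sub>R z)) has_real_derivative 0) (at 1)"
          by (rule has_field_derivative_transform_within_open[OF DERIV_const, where S="{\<tau><..}"])
            (use \<open>\<tau> < 1\<close> \<open>\<tau> > 0\<close> Ft in auto)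
        then show ?thesis using 2 by (simp add: bump_def)
      qed
    qed
    show "\<bar>F (t *\<^sub>R z) - F (1 *\<^sub>R z)\<bar> \<le> indicator (cball 0 2) z *\<^sub>R (2 * K) * \<bar>t - 1\<bar>"
      if t: "\<bar>t - 1\<bar> < 1/2" for t z
    proof -
      have t': "t > 1/2" using t by (auto simp: abs_if split: if_splits)
      consider "z = 0" | "norm z > 2" | "z \<noteq> 0" "norm z \<le> 2" by linarith
      then show ?thesis
      proof cases
        case 1
        then show ?thesis using K(1) by (simp add: F_def)
      next
        case 2
        then show ?thesis using out[OF t', of z] out[of 1 z] by simp
      next
        case 3
        define \<tau> where "\<tau> = 1 / norm z"
        have \<tau>: "\<tau> \<ge> 1/2" "\<tau> * norm z = 1" using 3 by (auto simp: \<tau>_def field_simps)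
        have "\<bar>U (min t \<tau> *\<^sub>R z) - U (min 1 \<tau> *\<^sub>R z)\<bar> \<le> (2 * K) * \<bar>min t \<tau> - min 1 \<tau>\<bar>"
        proof (rule real_mvt_bound)
          fix s assume "s \<in> closed_segment (min 1 \<tau>) (min t \<tau>)"
          then have s: "s \<ge> 1/2" "s \<le> \<tau>"
            using \<tau> t' by (auto simp: closed_segment_eq_real_ivl split: if_splits)
          have "s * norm z \<le> \<tau> * norm z" using s by (intro mult_right_mono) auto
          then have sz: "norm (s *\<^sub>R z) \<le> 1" using s \<tau> by simp
          show "((\<lambda>s. U (s *\<^sub>R z)) has_real_derivative V (s *\<^sub>R z) / s) (at s)"
            using ray[of s z] s sz by simp
          have "\<bar>V (s *\<^sub>R z)\<bar> / s \<le> K / (1/2)"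
            using s K(1) K(3)[OF sz] by (intro frac_le) auto
          then show "\<bar>V (s *\<^sub>R z) / s\<bar> \<le> 2 * K" using s by simp
        qed
        also have "\<dots> \<le> (2 * K) * \<bar>t - 1\<bar>"
          using K(1) by (intro mult_left_mono) (auto simp: min_def)
        finally show ?thesis
          using F_ray[OF 3(1), of t] F_ray[OF 3(1), of 1] t' 3 by (simp add: \<tau>_def)
      qed
    qed
  qed simp
  moreover have "((\<lambda>t. LINT z|lborel. F (t *\<^sub>R z)) has_real_derivative - real DIM('a) * I) (at 1)"
  proof (rule has_field_derivative_transform_within_open[where S="{0<..}"])
    show "((\<lambda>t. I / t ^ DIM('a)) has_real_derivative - real DIM('a) * I) (at 1)"
      by (auto intro!: derivative_eq_intros)
    show "I / t ^ DIM('a) = (LINT z|lborel. F (t *\<^sub>R z))" if "t \<in> {0<..}" for t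
      using integral_lborel_dilation[OF measF, of t] that by (simp add: I_def field_simps)
  qed auto
  ultimately have "(LINT z|lborel. bump 0 z * V z) = - real DIM('a) * I"
    by (rule DERIV_unique)
  moreover have "I = (LINT z|lborel. bump 0 z * U z - indicator (ball 0 1 - {0}) z *\<^sub>R W z)"
    unfolding I_def
  proof (rule integral_cong_AE)
    show "AE z in lborel. F z = bump 0 z * U z - indicator (ball 0 1 - {0}) z *\<^sub>R W z"
      using neq0 by eventually_elim (auto simp: F_def bump_def indicator_def)
  qed (use measF intU intW in auto)
  then have "I = (LINT z|lborel. bump 0 z * U z) - (LINT z|lborel. indicator (ball 0 1 - {0}) z *\<^sub>R W z)"
    using intU intW by simp
  moreover have "(LINT y|sphere_area. U y)
      = real DIM('a) * (LINT z|lborel. indicator (ball 0 1 - {0}) z *\<^sub>R W z)"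
    unfolding W_def
    by (rule integral_sphere_area) (rule continuous_on_subset[OF cU1], auto)
  ultimately show ?thesis by (simp add: algebra_simps)
qed

section \<open>Weighted ball integrals of panharmonic functions\<close>

lemma Ck_on_Suc_partial:
  assumes "Ck_on (Suc k) S u" "b \<in> Basis"
  shows "continuous_on S (partial_deriv b u)" "Ck_on k S (partial_deriv b u)"
    and "y \<in> S \<Longrightarrow> ((\<lambda>t. u (y + t *\<^sub>R b)) has_real_derivative partial_deriv b u y) (at 0)"
proof -
  show *: "Ck_on k S (partial_deriv b u)" using assms by simp
  then show "continuous_on S (partial_deriv b u)" by (cases k) auto
  show "((\<lambda>t. u (y + t *\<^sub>R b)) has_real_derivative partial_deriv b u y) (at 0)" if "y \<in> S"
    using assms that unfolding partial_deriv_def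
    by (auto simp: DERIV_deriv_iff_real_differentiable)
qed

text \<open>The value of the total derivative of \<open>u\<close> at \<open>y\<close> in direction \<open>v\<close>, for continuously
differentiable \<open>u\<close>.\<close>

definition dir_deriv :: "('a::euclidean_space \<Rightarrow> real) \<Rightarrow> 'a \<Rightarrow> 'a \<Rightarrow> real" where
  "dir_deriv u v y = (\<Sum>b\<in>Basis. (v \<bullet> b) * partial_deriv b u y)"

lemma has_dir_deriv:
  assumes S: "open S" and u: "Ck_on (Suc 0) S u" and y: "y + t *\<^sub>R v \<in> S"
  shows "((\<lambda>t. u (y + t *\<^sub>R v)) has_real_derivative dir_deriv u v (y + t *\<^sub>R v)) (at t)"
proof -
  have "(u has_derivative (\<lambda>h. dir_deriv u h (y + t *\<^sub>R v))) (at (y + t *\<^sub>R v))"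
    unfolding dir_deriv_def
    by (rule has_derivative_of_continuous_partials[OF S y])
      (use Ck_on_Suc_partial[OF u] in auto)
  moreover have "((\<lambda>t. y + t *\<^sub>R v) has_derivative (\<lambda>s. s *\<^sub>R v)) (at t)"
    by (auto intro!: derivative_eq_intros)
  ultimately have "((\<lambda>t. u (y + t *\<^sub>R v)) has_derivative (\<lambda>s. dir_deriv u (s *\<^sub>R v) (y + t *\<^sub>R v))) (at t)"
    by (rule has_derivative_compose[rotated])
  then show ?thesis
    by (rule has_derivative_imp_has_field_derivative)
      (simp add: dir_deriv_def sum_distrib_left mult_ac)
qed

text \<open>The substitution \<open>y = x + R *\<^sub>R z\<close> keeps the domain of integration fixed, so that differentiating
in \<open>R\<close> acts on \<open>u\<close> alone. Negative \<open>R\<close> is harmless and makes \<open>R = 0\<close> an interior point of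
the parameter range.\<close>

definition weighted_ball_integral :: "('a::euclidean_space \<Rightarrow> real) \<Rightarrow> 'a \<Rightarrow> nat \<Rightarrow> real \<Rightarrow> real" where
  "weighted_ball_integral u x k R = (LINT z|lborel. bump k z * u (x + R *\<^sub>R z))"

lemma scaled_ball_subset:
  fixes x z :: "'a::real_normed_vector"
  assumes "ball x s \<subseteq> S" "\<bar>R\<bar> * norm z < s"
  shows "x + R *\<^sub>R z \<in> S"
  using assms by (intro subsetD[OF assms(1)]) (simp add: dist_norm)

lemma weighted_ball_integral_has_derivative:
  fixes u :: "'a::euclidean_space \<Rightarrow> real"
  assumes S: "open S" and u: "Ck_on (Suc 0) S u" and ball: "ball x s \<subseteq> S" and R: "\<bar>R\<bar> < s"
  shows "(weighted_ball_integral u x k has_real_derivative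
          (LINT z|lborel. bump k z * dir_deriv u z (x + R *\<^sub>R z))) (at R)"
proof -
  define d where "d = (s - \<bar>R\<bar>) / 2"
  have d: "d > 0" "\<bar>R\<bar> + d < s" using R by (auto simp: d_def field_simps)
  have inS: "x + t *\<^sub>R z \<in> S" if "\<bar>t - R\<bar> \<le> d" "norm z \<le> 1" for t z
  proof (rule scaled_ball_subset[OF ball])
    have "\<bar>t\<bar> * norm z \<le> \<bar>t\<bar> * 1" using that by (intro mult_left_mono) auto
    then show "\<bar>t\<bar> * norm z < s" using that d by linarith
  qed
  have cu: "continuous_on S u" using u by simp
  have cp: "continuous_on S (partial_deriv b u)" if "b \<in> Basis" for b
    using Ck_on_Suc_partial(1)[OF u that] .
  define G where "G p = dir_deriv u (snd p) (x + fst p *\<^sub>R snd p)" for p :: "real \<times> 'a"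
  have "continuous_on (cball R d \<times> cball 0 1) G"
    unfolding G_def dir_deriv_def
    by (intro continuous_intros continuous_on_compose2[OF cp])
      (auto intro!: inS simp: dist_real_def abs_minus_commute)
  then have "bounded (G ` (cball R d \<times> cball 0 1))"
    by (intro compact_imp_bounded compact_continuous_image compact_Times compact_cball)
  then obtain K where K: "\<And>p. p \<in> cball R d \<times> cball 0 1 \<Longrightarrow> norm (G p) \<le> K"
    by (force simp: bounded_iff)
  show ?thesis
    unfolding weighted_ball_integral_def[abs_def]
  proof (rule has_real_derivative_under_integral[OF d(1), where B="\<lambda>z. bump k z * K"])
    show "integrable lborel (\<lambda>z. bump k z * u (x + t *\<^sub>R z))" if "\<bar>t - R\<bar> < d" for t
      using that inS[of t]
      by (intro integrable_bump continuous_on_compose2[OF cu] continuous_intros) auto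
    show "integrable lborel (\<lambda>z::'a. bump k z * K)"
      by (intro integrable_bump continuous_intros)
    have "integrable lborel (\<lambda>z. bump k z * dir_deriv u z (x + R *\<^sub>R z))"
      unfolding dir_deriv_def using inS[of R] d
      by (intro integrable_bump continuous_intros continuous_on_compose2[OF cp]) auto
    then show "(\<lambda>z. bump k z * dir_deriv u z (x + R *\<^sub>R z)) \<in> borel_measurable lborel"
      by auto
    show "AE z in lborel. ((\<lambda>t. bump k z * u (x + t *\<^sub>R z)) has_real_derivative
        bump k z * dir_deriv u z (x + R *\<^sub>R z)) (at R)"
    proof (rule AE_I2)
      fix z :: 'a
      show "((\<lambda>t. bump k z * u (x + t *\<^sub>R z)) has_real_derivative
        bump k z * dir_deriv u z (x + R *\<^sub>R z)) (at R)"
      proof (cases "norm z < 1")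
        case True
        then show ?thesis
          using inS[of R z] d by (intro DERIV_cmult has_dir_deriv[OF S u]) auto
      qed (simp add: bump_def)
    qed
    show "\<bar>bump k z * u (x + t *\<^sub>R z) - bump k z * u (x + R *\<^sub>R z)\<bar> \<le> bump k z * K * \<bar>t - R\<bar>"
      if t: "\<bar>t - R\<bar> < d" for t z
    proof (cases "norm z < 1")
      case True
      have "\<bar>u (x + t *\<^sub>R z) - u (x + R *\<^sub>R z)\<bar> \<le> K * \<bar>t - R\<bar>"
      proof (rule real_mvt_bound)
        fix s assume "s \<in> closed_segment R t"
        then have s: "\<bar>s - R\<bar> \<le> d"
          using t by (auto simp: closed_segment_eq_real_ivl split: if_splits)
        show "((\<lambda>s. u (x + s *\<^sub>R z)) has_real_derivative dir_deriv u z (x + s *\<^sub>R z)) (at s)"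
          using inS[OF s] True by (intro has_dir_deriv[OF S u]) auto
        show "\<bar>dir_deriv u z (x + s *\<^sub>R z)\<bar> \<le> K"
          using K[of "(s, z)"] s True by (simp add: G_def dist_real_def abs_minus_commute)
      qed
      then have "bump k z * \<bar>u (x + t *\<^sub>R z) - u (x + R *\<^sub>R z)\<bar> \<le> bump k z * (K * \<bar>t - R\<bar>)"
        by (intro mult_left_mono bump_nonneg)
      then show ?thesis
        using bump_nonneg[of k z] by (simp add: right_diff_distrib[symmetric] abs_mult mult.assoc)
    qed (simp add: bump_def)
  qed
qed

text \<open>Apply integration by parts to each component \<open>w z = \<partial>\<^sub>b u (x + R *\<^sub>R z)\<close> of the gradient. The
derivative of \<open>w\<close> along \<open>b\<close> is \<open>R\<close> times the second partial derivative, and summation over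
\<open>b\<close> yields the Laplacian.\<close>

lemma weighted_ball_integral_Laplacian:
  fixes u :: "'a::euclidean_space \<Rightarrow> real"
  assumes S: "open S" and u: "Ck_on (Suc (Suc 0)) S u" and ball: "ball x s \<subseteq> S" and R: "\<bar>R\<bar> < s"
  shows "2 * real (Suc k) * (LINT z|lborel. bump k z * dir_deriv u z (x + R *\<^sub>R z))
       = R * weighted_ball_integral (Laplacian u) x (Suc k) R"
proof -
  \<comment> \<open>Dividing by s instead of \<open>\<bar>R\<bar>\<close> covers the case \<open>R = 0\<close>.\<close>
  define e where "e = (s - \<bar>R\<bar>) / s"
  have s: "s > 0" using R by simp
  have e: "e > 0" using R s by (simp add: e_def)
  have "\<bar>R\<bar> * (1 + e) \<le> s"
  proof -
    have "\<bar>R\<bar> * e \<le> s * e" using R e by (intro mult_right_mono) auto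
    also have "s * e = s - \<bar>R\<bar>" using s by (simp add: e_def)
    finally show ?thesis by (simp add: algebra_simps)
  qed
  have inS: "x + R *\<^sub>R z \<in> S" if "z \<in> ball 0 (1 + e)" for z
  proof (rule scaled_ball_subset[OF ball], cases "R = 0")
    case False
    have "\<bar>R\<bar> * norm z < \<bar>R\<bar> * (1 + e)" using that False by simp
    then show "\<bar>R\<bar> * norm z < s" using \<open>\<bar>R\<bar> * (1 + e) \<le> s\<close> by simp
  qed (use s in simp)
  let ?p = "\<lambda>b. partial_deriv b u" and ?q = "\<lambda>b. partial_deriv b (partial_deriv b u)"
  have cp: "continuous_on S (?p b)" and cq: "continuous_on S (?q b)" if "b \<in> Basis" for b
    using Ck_on_Suc_partial[OF u that] Ck_on_Suc_partial[OF _ that] by blast+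
  have cp': "continuous_on (ball 0 (1 + e)) (\<lambda>z. ?p b (x + R *\<^sub>R z))"
    and cq': "continuous_on (ball 0 (1 + e)) (\<lambda>z. ?q b (x + R *\<^sub>R z))" if "b \<in> Basis" for b
    using inS by (auto intro!: continuous_on_compose2[OF cp[OF that]] continuous_on_compose2[OF cq[OF that]] continuous_intros)
  have c1: "cball (0::'a) 1 \<subseteq> ball 0 (1 + e)" using e by auto
  have by_parts: "(LINT z|lborel. bump (Suc k) z * (R * ?q b (x + R *\<^sub>R z)))
      = 2 * real (Suc k) * (LINT z|lborel. bump k z * ((z \<bullet> b) * ?p b (x + R *\<^sub>R z)))"
    if b: "b \<in> Basis" for b
  proof (rule integral_bump_by_parts[OF b e cp'[OF b]])
    show "continuous_on (ball 0 (1 + e)) (\<lambda>z. R * ?q b (x + R *\<^sub>R z))"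
      by (intro continuous_intros cq' b)
    fix z :: 'a assume "z \<in> ball 0 (1 + e)"
    then have "x + R *\<^sub>R z \<in> S" by (rule inS)
    then have "((\<lambda>t. ?p b (x + R *\<^sub>R z + t *\<^sub>R b)) has_real_derivative ?q b (x + R *\<^sub>R z)) (at (R * 0))"
      using Ck_on_Suc_partial(3)[OF Ck_on_Suc_partial(2)[OF u b] b] by simp
    from DERIV_chain2[OF this DERIV_cmult_Id]
    show "((\<lambda>t. ?p b (x + R *\<^sub>R (z + t *\<^sub>R b))) has_real_derivative R * ?q b (x + R *\<^sub>R z)) (at 0)"
      by (simp add: algebra_simps)
  qed
  have int1: "integrable lborel (\<lambda>z. bump k z * ((z \<bullet> b) * ?p b (x + R *\<^sub>R z)))" if "b \<in> Basis" for b
    by (intro integrable_bump continuous_intros continuous_on_subset[OF cp'[OF that] c1])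
  have int2: "integrable lborel (\<lambda>z. bump (Suc k) z * (R * ?q b (x + R *\<^sub>R z)))" if "b \<in> Basis" for b
    by (intro integrable_bump continuous_intros continuous_on_subset[OF cq'[OF that] c1])
  have "2 * real (Suc k) * (LINT z|lborel. bump k z * dir_deriv u z (x + R *\<^sub>R z))
      = 2 * real (Suc k) * (LINT z|lborel. (\<Sum>b\<in>Basis. bump k z * ((z \<bullet> b) * ?p b (x + R *\<^sub>R z))))"
    by (simp only: dir_deriv_def sum_distrib_left)
  also have "\<dots> = (\<Sum>b\<in>Basis. 2 * real (Suc k) * (LINT z|lborel. bump k z * ((z \<bullet> b) * ?p b (x + R *\<^sub>R z))))"
    by (subst Bochner_Integration.integral_sum[OF int1]) (simp_all only: sum_distrib_left)
  also have "\<dots> = (\<Sum>b\<in>Basis. LINT z|lborel. bump (Suc k) z * (R * ?q b (x + R *\<^sub>R z)))"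
    by (intro sum.cong refl by_parts[symmetric])
  also have "\<dots> = (LINT z|lborel. (\<Sum>b\<in>Basis. bump (Suc k) z * (R * ?q b (x + R *\<^sub>R z))))"
    by (rule Bochner_Integration.integral_sum[OF int2, symmetric])
  also have "(\<lambda>z. \<Sum>b\<in>Basis. bump (Suc k) z * (R * ?q b (x + R *\<^sub>R z)))
      = (\<lambda>z. R * (bump (Suc k) z * Laplacian u (x + R *\<^sub>R z)))"
    by (auto simp: Laplacian_def sum_distrib_left mult_ac)
  finally show ?thesis
    by (simp add: weighted_ball_integral_def)
qed

lemma Ck_on_Suc_lower: "Ck_on (Suc k) S u \<Longrightarrow> Ck_on k S u"
  by (induction k arbitrary: u) auto

lemma panharmonic_onD:
  assumes "panharmonic_on \<mu> S u"
  shows "open S" "Ck_on (Suc (Suc 0)) S u" "Ck_on (Suc 0) S u" "continuous_on S u"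
    and "x \<in> S \<Longrightarrow> Laplacian u x = \<mu>\<^sup>2 * u x"
proof -
  show "open S" using assms by (simp add: panharmonic_on_def)
  show C2: "Ck_on (Suc (Suc 0)) S u"
    using assms unfolding panharmonic_on_def numeral_2_eq_2 by blast
  from Ck_on_Suc_lower[OF C2] show "Ck_on (Suc 0) S u" .
  then show "continuous_on S u" by simp
  show "Laplacian u x = \<mu>\<^sup>2 * u x" if "x \<in> S"
    using assms that by (simp add: panharmonic_on_def)
qed

text \<open>For panharmonic \<open>u\<close> the Laplacian is a multiple of \<open>u\<close> itself, and the family of weighted
integrals becomes closed under differentiation in the radius: each differentiation raises the
exponent of the weight by one.\<close>

lemma weighted_ball_integral_panharmonic:
  fixes u :: "'a::euclidean_space \<Rightarrow> real"
  assumes pan: "panharmonic_on \<mu> S u" and ball: "ball x s \<subseteq> S" and R: "\<bar>R\<bar> < s"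
  shows "2 * real (Suc k) * (LINT z|lborel. bump k z * dir_deriv u z (x + R *\<^sub>R z))
         = \<mu>\<^sup>2 * R * weighted_ball_integral u x (Suc k) R" (is "_ * ?I = _")
    and "(weighted_ball_integral u x k has_real_derivative
          \<mu>\<^sup>2 * R / (2 * real (Suc k)) * weighted_ball_integral u x (Suc k) R) (at R)"
proof -
  note pan = panharmonic_onD[OF pan]
  have "bump (Suc k) z * Laplacian u (x + R *\<^sub>R z) = \<mu>\<^sup>2 * (bump (Suc k) z * u (x + R *\<^sub>R z))" for z
  proof (cases "norm z < 1")
    case True
    have "\<bar>R\<bar> * norm z \<le> \<bar>R\<bar> * 1" using True by (intro mult_left_mono) auto
    then have "x + R *\<^sub>R z \<in> S" using R by (intro scaled_ball_subset[OF ball]) simp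
    then show ?thesis using pan(5) by simp
  qed (simp add: bump_def)
  then have "weighted_ball_integral (Laplacian u) x (Suc k) R = \<mu>\<^sup>2 * weighted_ball_integral u x (Suc k) R"
    unfolding weighted_ball_integral_def by (simp only: integral_mult_right_zero)
  with weighted_ball_integral_Laplacian[OF pan(1,2) ball R, of k]
  show *: "2 * real (Suc k) * ?I = \<mu>\<^sup>2 * R * weighted_ball_integral u x (Suc k) R"
    by simp
  then have "?I = \<mu>\<^sup>2 * R / (2 * real (Suc k)) * weighted_ball_integral u x (Suc k) R"
    by (simp add: field_simps del: of_nat_Suc)
  then show "(weighted_ball_integral u x k has_real_derivative
          \<mu>\<^sup>2 * R / (2 * real (Suc k)) * weighted_ball_integral u x (Suc k) R) (at R)"
    using weighted_ball_integral_has_derivative[OF pan(1,3) ball R, of k] by simp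
qed

text \<open>At radius zero the weighted integral is \<open>u x\<close> times the integral of the weight, so the Taylor
series has explicit coefficients.\<close>

lemma weighted_ball_integral_series:
  fixes u :: "'a::euclidean_space \<Rightarrow> real"
  assumes pan: "panharmonic_on \<mu> S u" and ball: "ball x s \<subseteq> S" and R: "0 \<le> R" "R < s"
  shows "(\<lambda>n. u x * pi powr (real DIM('a) / 2) * fact k * (\<mu> * R / 2) ^ (2 * n)
              / (fact n * Gamma (real (k + n) + real DIM('a) / 2 + 1))) sums weighted_ball_integral u x k R"
proof -
  have cball: "cball x R \<subseteq> S"
    using ball R by (auto simp: subset_eq)
  have cu: "continuous_on (cball x R) u"
    using panharmonic_onD(4)[OF pan] cball by (rule continuous_on_subset)
  obtain K where K: "\<And>y. y \<in> cball x R \<Longrightarrow> norm (u y) \<le> K"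
    using compact_imp_bounded[OF compact_continuous_image[OF cu compact_cball]]
    by (force simp: bounded_iff)
  have K0: "K \<ge> 0" using K[of x] R by simp
  have "(\<lambda>n. weighted_ball_integral u x (k + n) 0 * fact k / (fact n * fact (k + n)) * (\<mu> * R / 2) ^ (2 * n))
        sums weighted_ball_integral u x k R"
  proof (rule iterated_derivative_series)
    show "(weighted_ball_integral u x k has_real_derivative
          \<mu>\<^sup>2 * t / (2 * real (Suc k)) * weighted_ball_integral u x (Suc k) t) (at t)"
      if "0 \<le> t" "t \<le> R" for k t
      using that R by (intro weighted_ball_integral_panharmonic(2)[OF pan ball]) auto
    show "\<bar>weighted_ball_integral u x k t\<bar> \<le> (LINT z|lborel. bump 0 (z::'a) * K)" if t: "0 \<le> t" "t \<le> R" for k t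
    proof -
      have inR: "x + t *\<^sub>R z \<in> cball x R" if "norm z \<le> 1" for z
        using mult_mono[OF t(2) that] t R by (simp add: dist_norm)
      have int: "integrable lborel (\<lambda>z. bump k z * u (x + t *\<^sub>R z))"
        using inR by (intro integrable_bump continuous_on_compose2[OF cu] continuous_intros) auto
      have "\<bar>weighted_ball_integral u x k t\<bar> \<le> (LINT z|lborel. \<bar>bump k z * u (x + t *\<^sub>R z)\<bar>)"
        unfolding weighted_ball_integral_def by (rule integral_abs_bound)
      also have "\<dots> \<le> (LINT z|lborel. bump 0 (z::'a) * K)"
      proof (rule integral_mono)
        show "integrable lborel (\<lambda>z. \<bar>bump k z * u (x + t *\<^sub>R z)\<bar>)"
          using int by (rule integrable_abs)
        show "integrable lborel (\<lambda>z::'a. bump 0 z * K)"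
          by (intro integrable_bump continuous_intros)
        show "\<bar>bump k z * u (x + t *\<^sub>R z)\<bar> \<le> bump 0 z * K" for z
        proof (cases "norm z < 1")
          case True
          have "bump k z * \<bar>u (x + t *\<^sub>R z)\<bar> \<le> 1 * K"
            using K[OF inR[of z]] True bump_nonneg[of k z] bump_le_1[of k z] K0 by (intro mult_mono) auto
          then show ?thesis
            using True bump_nonneg[of k z] by (simp add: abs_mult) (simp add: bump_def)
        qed (simp add: bump_def)
      qed
      finally show ?thesis .
    qed
  qed (use R in simp)
  moreover have "weighted_ball_integral u x j 0 = u x * bump_integral TYPE('a) j" for j
    by (simp add: weighted_ball_integral_def bump_integral_def)
  ultimately show ?thesis
    by (simp add: bump_integral_eq mult_ac)
qed

section \<open>The mean value property\<close>

text \<open>By compactness the closed ball keeps a positive distance from the complement of \<open>S\<close>.\<close>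

lemma cball_subset_open_imp_larger_ball:
  fixes x :: "'a::euclidean_space"
  assumes "open S" "cball x r \<subseteq> S" "r \<ge> 0"
  obtains s where "s > r" "ball x s \<subseteq> S"
proof -
  obtain d where d: "d > 0" "(\<Union>y\<in>cball x r. ball y d) \<subseteq> S"
    using compact_subset_open_imp_ball_epsilon_subset[OF compact_cball assms(1,2)] by blast
  have "ball x (r + d) \<subseteq> S"
  proof
    fix y assume "y \<in> ball x (r + d)"
    then have y: "dist x y < r + d" by simp
    show "y \<in> S"
    proof (cases "dist x y \<le> r")
      case False
      define w where "w = x + (r / dist x y) *\<^sub>R (y - x)"
      have nz: "dist x y > 0" using False assms(3) by linarith
      have "dist x w = r"
        using nz assms(3) by (simp add: w_def dist_norm norm_minus_commute)
      moreover have "y - w = (1 - r / dist x y) *\<^sub>R (y - x)"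
        by (simp add: w_def algebra_simps)
      then have "dist w y = (1 - r / dist x y) * dist x y"
        using False nz by (simp add: dist_norm norm_minus_commute[of w y] norm_minus_commute[of x y])
      then have "dist w y = dist x y - r" using nz by (simp add: left_diff_distrib)
      ultimately have "w \<in> cball x r" "y \<in> ball w d" using y by simp_all
      then show ?thesis using d(2) by blast
    qed (use assms(2) in auto)
  qed
  then show thesis using d(1) by (intro that[of "r + d"]) auto
qed

text \<open>The mean value property. The divergence theorem on the ball expresses the sphere integral by the
weighted ball integrals with exponents \<open>0\<close> and \<open>1\<close>. Adding their two series, the factor
\<open>m + n\<close> that appears (with \<open>m\<close> half the dimension) lowers the argument of the Gamma function by
one and produces the series of \<open>a_circ\<close>.\<close>

lemma spherical_mean_panharmonic:
  fixes u :: "'a::euclidean_space \<Rightarrow> real"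
  assumes pan: "panharmonic_on \<mu> S u" and cball: "cball x r \<subseteq> S" and r: "r > 0"
  shows "spherical_mean u x r = a_circ DIM('a) (\<mu> * r) * u x"
proof -
  note C = panharmonic_onD[OF pan]
  obtain s where s: "s > r" and ball: "ball x s \<subseteq> S"
    using cball_subset_open_imp_larger_ball[OF C(1) cball] r by auto
  have rs: "\<bar>r\<bar> < s" using r s by simp
  define e where "e = s / r - 1"
  have e: "e > 0" "r * (1 + e) = s" using r s by (auto simp: e_def field_simps)
  define m where "m = real DIM('a) / 2"
  have m: "m > 0" by (simp add: m_def)
  have inS: "x + r *\<^sub>R z \<in> S" if "z \<in> ball 0 (1 + e)" for z
    using that r e by (intro scaled_ball_subset[OF ball]) (simp add: e(2)[symmetric])
  have "(LINT y|sphere_area. u (x + r *\<^sub>R y))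
      = real DIM('a) * (LINT z|lborel. bump 0 z * u (x + r *\<^sub>R z))
        + (LINT z|lborel. bump 0 z * dir_deriv u (r *\<^sub>R z) (x + r *\<^sub>R z))"
  proof (rule sphere_integral_eq_ball_integrals[OF e(1)])
    show "continuous_on (ball 0 (1 + e)) (\<lambda>z. u (x + r *\<^sub>R z))"
      using inS by (intro continuous_on_compose2[OF C(4)] continuous_intros) auto
    show "continuous_on (ball 0 (1 + e)) (\<lambda>z. dir_deriv u (r *\<^sub>R z) (x + r *\<^sub>R z))"
      unfolding dir_deriv_def using inS
      by (intro continuous_intros continuous_on_compose2[OF Ck_on_Suc_partial(1)[OF C(3)]]) auto
    fix z :: 'a assume "z \<in> ball 0 (1 + e)"
    then show "((\<lambda>t. u (x + r *\<^sub>R (t *\<^sub>R z))) has_real_derivative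
        dir_deriv u (r *\<^sub>R z) (x + r *\<^sub>R z)) (at 1)"
      using has_dir_deriv[OF C(1,3), of x 1 "r *\<^sub>R z"] inS[of z] by (simp add: mult.commute)
  qed
  also have "(\<lambda>z. bump 0 z * dir_deriv u (r *\<^sub>R z) (x + r *\<^sub>R z))
      = (\<lambda>z. r * (bump 0 z * dir_deriv u z (x + r *\<^sub>R z)))"
    by (auto simp: dir_deriv_def sum_distrib_left mult_ac)
  also have "(LINT z|lborel. r * (bump 0 z * dir_deriv u z (x + r *\<^sub>R z)))
      = 2 * (\<mu> * r / 2)\<^sup>2 * weighted_ball_integral u x 1 r"
    using weighted_ball_integral_panharmonic(1)[OF pan ball rs, of 0]
    by (simp add: power2_eq_square)
  finally have mean: "(LINT y|sphere_area. u (x + r *\<^sub>R y))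
      = 2 * m * weighted_ball_integral u x 0 r + 2 * (\<mu> * r / 2)\<^sup>2 * weighted_ball_integral u x 1 r"
    by (simp add: weighted_ball_integral_def m_def)
  define a where "a n = u x * pi powr m * (\<mu> * r / 2) ^ (2 * n) / (fact n * Gamma (real n + m + 1))" for n
  have series0: "(\<lambda>n. 2 * m * a n) sums (2 * m * weighted_ball_integral u x 0 r)"
    using weighted_ball_integral_series[OF pan ball, of r 0] r rs
    by (intro sums_mult) (simp add: a_def m_def)
  have "(\<lambda>n. 2 * (\<mu> * r / 2)\<^sup>2 * (u x * pi powr m * (\<mu> * r / 2) ^ (2 * n)
              / (fact n * Gamma (real (Suc n) + m + 1)))) sums (2 * (\<mu> * r / 2)\<^sup>2 * weighted_ball_integral u x 1 r)"
    using weighted_ball_integral_series[OF pan ball, of r 1] r rs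
    by (intro sums_mult) (simp add: m_def)
  also have "(\<lambda>n. 2 * (\<mu> * r / 2)\<^sup>2 * (u x * pi powr m * (\<mu> * r / 2) ^ (2 * n)
              / (fact n * Gamma (real (Suc n) + m + 1)))) = (\<lambda>n. 2 * real (Suc n) * a (Suc n))"
  proof
    fix n
    have "(\<mu> * r / 2) ^ (2 * Suc n) = (\<mu> * r / 2)\<^sup>2 * (\<mu> * r / 2) ^ (2 * n)"
      by (simp add: power2_eq_square)
    then show "2 * (\<mu> * r / 2)\<^sup>2 * (u x * pi powr m * (\<mu> * r / 2) ^ (2 * n)
              / (fact n * Gamma (real (Suc n) + m + 1))) = 2 * real (Suc n) * a (Suc n)"
      unfolding a_def fact_Suc by (simp only: times_divide_eq_right) (simp del: of_nat_Suc)
  qed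
  finally have "(\<lambda>n. 2 * real (Suc n) * a (Suc n)) sums (2 * (\<mu> * r / 2)\<^sup>2 * weighted_ball_integral u x 1 r)" .
  \<comment> \<open>Index shift: the additional term for n = 0 vanishes because of the factor n.\<close>
  then have series1: "(\<lambda>n. 2 * real n * a n) sums (2 * (\<mu> * r / 2)\<^sup>2 * weighted_ball_integral u x 1 r)"
    by (subst (asm) sums_Suc_iff) simp
  have "(\<lambda>n. 2 * m * a n + 2 * real n * a n) sums (LINT y|sphere_area. u (x + r *\<^sub>R y))"
    unfolding mean by (rule sums_add[OF series0 series1])
  also have "(\<lambda>n. 2 * m * a n + 2 * real n * a n)
      = (\<lambda>n. 2 * pi powr m * u x * ((\<mu> * r / 2) ^ (2 * n) / (fact n * Gamma (real n + m))))"
  proof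
    fix n
    have pos: "real n + m > 0" using m by simp
    then have "real n + m \<notin> \<int>\<^sub>\<le>\<^sub>0" by (auto dest: nonpos_Ints_nonpos)
    from Gamma_plus1[OF this] have G: "Gamma (real n + m + 1) = (real n + m) * Gamma (real n + m)" .
    have "2 * m * a n + 2 * real n * a n = 2 * ((real n + m) * a n)"
      by (simp add: algebra_simps)
    also have "(real n + m) * a n = u x * pi powr m * (\<mu> * r / 2) ^ (2 * n) / (fact n * Gamma (real n + m))"
      unfolding a_def G using pos by simp
    finally show "2 * m * a n + 2 * real n * a n
        = 2 * pi powr m * u x * ((\<mu> * r / 2) ^ (2 * n) / (fact n * Gamma (real n + m)))"
      by simp
  qed
  finally have "(\<lambda>n. 2 * pi powr m * u x * ((\<mu> * r / 2) ^ (2 * n) / (fact n * Gamma (real n + m))))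
      sums (LINT y|sphere_area. u (x + r *\<^sub>R y))" .
  from sums_mult[OF this, of "1 / sphere_const DIM('a)"]
  have "(\<lambda>n. 1 / sphere_const DIM('a) * (2 * pi powr m * u x *
          ((\<mu> * r / 2) ^ (2 * n) / (fact n * Gamma (real n + m))))) sums spherical_mean u x r"
    by (simp only: spherical_mean_def)
  also have "(\<lambda>n. 1 / sphere_const DIM('a) * (2 * pi powr m * u x *
          ((\<mu> * r / 2) ^ (2 * n) / (fact n * Gamma (real n + m)))))
      = (\<lambda>n. u x * Gamma m * ((\<mu> * r / 2) ^ (2 * n) / (fact n * Gamma (real n + m))))"
  proof -
    have "1 / sphere_const DIM('a) * (2 * pi powr m * u x) = u x * Gamma m"
      using Gamma_real_pos[OF m] by (simp add: sphere_const_def m_def)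
    then show ?thesis by (simp only: mult.assoc[symmetric])
  qed
  finally have sums: "(\<lambda>n. u x * Gamma m * ((\<mu> * r / 2) ^ (2 * n) / (fact n * Gamma (real n + m))))
      sums spherical_mean u x r" .
  show ?thesis
  proof (cases "u x = 0")
    case True
    then show ?thesis using sums sums_unique2[OF sums_zero] by fastforce
  next
    case False
    then have "summable (\<lambda>n. (\<mu> * r / 2) ^ (2 * n) / (fact n * Gamma (real n + m)))"
      using sums_summable[OF sums] Gamma_real_pos[OF m] by (subst (asm) summable_cmult_iff) auto
    from sums_unique[OF sums] suminf_mult[OF this, of "u x * Gamma m"]
    show ?thesis by (simp add: a_circ_def m_def)
  qed
qed

section \<open>Panharmonicity of constant multiples\<close>

lemma partial_deriv_cong:
  assumes "open S" "x \<in> S" "\<And>y. y \<in> S \<Longrightarrow> f y = g y"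
  shows "partial_deriv b f x = partial_deriv b g x"
proof -
  have "open ((\<lambda>t. x + t *\<^sub>R b) -` S)"
    using assms(1) by (intro open_vimage continuous_intros)
  then have "eventually (\<lambda>t. t \<in> (\<lambda>t. x + t *\<^sub>R b) -` S) (nhds 0)"
    by (rule eventually_nhds_in_open) (use assms(2) in simp)
  then show ?thesis
    unfolding partial_deriv_def
    by (intro deriv_cong_ev refl) (auto elim!: eventually_mono intro: assms(3))
qed

text \<open>On an open set, partial derivatives of all orders depend only on the values in that set.\<close>

lemma Ck_on_cong:
  assumes "open S" "\<And>y. y \<in> S \<Longrightarrow> f y = g y" "Ck_on k S f"
  shows "Ck_on k S g"
  using assms(2,3)
proof (induction k arbitrary: f g)
  case 0
  then show ?case by (simp cong: continuous_on_cong)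
next
  case (Suc k)
  show ?case
    unfolding Ck_on.simps
  proof (intro conjI ballI)
    have "continuous_on S f" using Suc.prems(2) by simp
    then show "continuous_on S g"
      using Suc.prems(1) by (simp cong: continuous_on_cong)
    fix b :: 'a assume b: "b \<in> Basis"
    show "Ck_on k S (partial_deriv b g)"
    proof (rule Suc.IH)
      show "partial_deriv b f y = partial_deriv b g y" if "y \<in> S" for y
        by (rule partial_deriv_cong[OF assms(1) that Suc.prems(1)])
      show "Ck_on k S (partial_deriv b f)"
        by (rule Ck_on_Suc_partial(2)[OF Suc.prems(2) b])
    qed
    fix x assume x: "x \<in> S"
    have "((\<lambda>t. g (x + t *\<^sub>R b)) has_real_derivative partial_deriv b f x) (at 0)"
    proof (rule has_field_derivative_transform_within_open)
      show "((\<lambda>t. f (x + t *\<^sub>R b)) has_real_derivative partial_deriv b f x) (at 0)"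
        by (rule Ck_on_Suc_partial(3)[OF Suc.prems(2) b x])
      show "open ((\<lambda>t. x + t *\<^sub>R b) -` S)"
        using assms(1) by (intro open_vimage continuous_intros)
    qed (use x Suc.prems(1) in auto)
    then show "(\<lambda>t. g (x + t *\<^sub>R b)) differentiable (at 0)"
      unfolding real_differentiable_def by (rule exI)
  qed
qed

lemma Ck_on_subset: "Ck_on k S f \<Longrightarrow> T \<subseteq> S \<Longrightarrow> Ck_on k T f"
  by (induction k arbitrary: f) (auto intro: continuous_on_subset)

lemma partial_deriv_cmult:
  assumes "(\<lambda>t. f (x + t *\<^sub>R b)) differentiable (at 0)"
  shows "partial_deriv b (\<lambda>y. c * f y) x = c * partial_deriv b f x"
  using assms unfolding partial_deriv_def
  by (intro DERIV_imp_deriv DERIV_cmult) (simp add: DERIV_deriv_iff_real_differentiable)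

lemma Ck_on_cmult:
  assumes "open S" "Ck_on k S f"
  shows "Ck_on k S (\<lambda>y. c * f y)"
  using assms(2)
proof (induction k arbitrary: f)
  case 0
  then show ?case by (auto intro: continuous_intros)
next
  case (Suc k)
  have "Ck_on k S (partial_deriv b (\<lambda>y. c * f y))" if b: "b \<in> Basis" for b
  proof (rule Ck_on_cong[OF assms(1)])
    show "Ck_on k S (\<lambda>y. c * partial_deriv b f y)"
      using Suc.prems b by (intro Suc.IH) auto
    show "c * partial_deriv b f y = partial_deriv b (\<lambda>y. c * f y) y" if "y \<in> S" for y
      using Suc.prems b that by (intro partial_deriv_cmult[symmetric]) auto
  qed
  then show ?case
    using Suc.prems by (auto intro!: continuous_intros derivative_intros)
qed

text \<open>Since \<open>f\<close> is only known on \<open>T\<close>, this is the form needed for the spherical mean, which agrees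
with a constant multiple of \<open>u\<close> on \<open>inner_set D r\<close>.\<close>

lemma panharmonic_on_cmult:
  assumes pan: "panharmonic_on \<mu> S u" and T: "open T" "T \<subseteq> S"
    and f: "\<And>y. y \<in> T \<Longrightarrow> f y = c * u y"
  shows "panharmonic_on \<mu> T f"
proof -
  note C = panharmonic_onD[OF pan]
  have u2: "Ck_on (Suc (Suc 0)) T u"
    using C(2) T(2) by (rule Ck_on_subset)
  have "Ck_on (Suc (Suc 0)) T f"
    by (rule Ck_on_cong[OF T(1) _ Ck_on_cmult[OF T(1) u2, of c]]) (simp add: f)
  moreover have "Laplacian f x = c * Laplacian u x" if x: "x \<in> T" for x
  proof -
    have "partial_deriv b (partial_deriv b f) x = c * partial_deriv b (partial_deriv b u) x"
      if b: "b \<in> Basis" for b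
    proof -
      have "partial_deriv b f y = c * partial_deriv b u y" if "y \<in> T" for y
      proof -
        have "partial_deriv b f y = partial_deriv b (\<lambda>y. c * u y) y"
          by (rule partial_deriv_cong[OF T(1) that f])
        also have "\<dots> = c * partial_deriv b u y"
          using u2 b that by (intro partial_deriv_cmult) auto
        finally show ?thesis .
      qed
      then have "partial_deriv b (partial_deriv b f) x = partial_deriv b (\<lambda>y. c * partial_deriv b u y) x"
        by (rule partial_deriv_cong[OF T(1) x])
      also have "\<dots> = c * partial_deriv b (partial_deriv b u) x"
        using u2 b x by (intro partial_deriv_cmult) auto
      finally show ?thesis .
    qed
    then show ?thesis by (simp add: Laplacian_def sum_distrib_left)
  qed
  then have "Laplacian f x - \<mu>\<^sup>2 * f x = 0" if "x \<in> T" for x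
    using C(5)[of x] that T(2) f[OF that] by auto
  ultimately show ?thesis
    using T(1) by (simp only: panharmonic_on_def numeral_2_eq_2) blast
qed

lemma open_inner_set:
  assumes "open D" "r \<ge> 0"
  shows "open (inner_set D r)"
  unfolding open_contains_ball
proof
  fix x assume "x \<in> inner_set D r"
  then obtain s where s: "s > r" "ball x s \<subseteq> D"
    using cball_subset_open_imp_larger_ball[OF assms(1) _ assms(2)] by (auto simp: inner_set_def)
  have "cball y r \<subseteq> ball x s" if "y \<in> ball x (s - r)" for y
  proof
    fix z assume "z \<in> cball y r"
    then show "z \<in> ball x s"
      using that dist_triangle[of x z y] by simp
  qed
  then have "ball x (s - r) \<subseteq> inner_set D r"
    using s(2) assms(2) by (force simp: inner_set_def)
  then show "\<exists>e>0. ball x e \<subseteq> inner_set D r"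
    using s(1) by (intro exI[of _ "s - r"]) simp
qed

theorem corollary2p3:
  fixes D :: "(real ^ 'n) set" and u :: "real ^ 'n \<Rightarrow> real" and \<mu> r :: real
  assumes "CARD('n) \<ge> 2"
    and "\<mu> \<noteq> 0"
    and "open D" and "connected D"
    and "panharmonic_on \<mu> D u"
    and "r > 0"
    and "inner_set D r \<noteq> {}"
  shows "panharmonic_on \<mu> (inner_set D r) (\<lambda>x. spherical_mean u x r) \<and>
    (\<forall>x \<in> inner_set D r. \<forall>r'>0. cball x r' \<subseteq> inner_set D r \<longrightarrow>
       iterated_mean u x r' r = a_circ CARD('n) (\<mu> * r') * spherical_mean u x r \<and>
       a_circ CARD('n) (\<mu> * r') * spherical_mean u x r =
         a_circ CARD('n) (\<mu> * r') * a_circ CARD('n) (\<mu> * r) * u x)"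
proof -
  have mean: "spherical_mean u x r = a_circ CARD('n) (\<mu> * r) * u x" if "x \<in> inner_set D r" for x
    using spherical_mean_panharmonic[OF assms(5) _ assms(6), of x] that
    by (simp add: inner_set_def)
  have pan: "panharmonic_on \<mu> (inner_set D r) (\<lambda>x. spherical_mean u x r)"
    using open_inner_set[OF assms(3), of r] assms(6) mean
    by (intro panharmonic_on_cmult[OF assms(5)]) (auto simp: inner_set_def)
  have "iterated_mean u x r' r = a_circ CARD('n) (\<mu> * r') * spherical_mean u x r"
    if "r' > 0" "cball x r' \<subseteq> inner_set D r" for x r'
    using spherical_mean_panharmonic[OF pan that(2,1)] by (simp add: iterated_mean_def)
  then show ?thesis
    using pan mean by simp
qed

end
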